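(* For each $n=2^d-1$ ($d$ a positive integer), choose an integer $r$ and a primitive element $\theta\in\mathbb{F}_{2^d}$ (both possibly depending on $n$), and let $Y_{n,\theta}$ be the Galois sequence of length $n$ with respect to $\theta$. Let $T>0$ be real and let $t\ge0$ be an integer that may depend on $n$. Then the following hold, as $n\to\infty$: (i) If $t/n\to T$, then $F(Y_{n,\theta}^{r,t})\to h(T)$. (ii) If $t/(2n)\to T$, then $F(N(Y_{n,\theta})^{r,t})\to h(T)$. (iii) If $t/(4n)\to T$, then $F(P(Y_{n,\theta})^{r,t})\to h(T)$.
   Context: A binary sequence of length $t>1$ is an element $A=(a_0,\dots,a_{t-1})\in\{-1,1\}^t$. Its aperiodic autocorrelation at shift $u\in\{0,\dots,t-1\}$ is $c_u=\sum_{j=0}^{t-u-1}a_ja_{j+u}$, and its merit factor is $F(A)=\dfrac{t^2}{2\sum_{u=1}^{t-1}c_u^2}$. A binary sequence $(a_0,\dots,a_{n-1})$ is identified with the polynomial $A(z)=\sum_{j=0}^{n-1}a_jz^j$, of which it is called the coefficient sequence; $F(A)$ denotes the merit factor of the coefficient sequence. Extend $a_j$ to all $j\in\mathbb{Z}$ by $a_{j+n}=a_j$. For integers $r$ and $t\ge0$ define $A^{r,t}(z)=\sum_{j=0}^{t-1}a_{j+r}z^j$ (a sequence of length $t$). Define two polynomials of length $4n$: $$N(A)(z)=\sum_{j=0}^{4n-1}(-1)^{j(j-1)/2}a_jz^j,\qquad P(A)(z)=\sum_{j=0}^{4n-1}(-1)^{j(j-1)^2/2}a_jz^j.$$ In $N(A)^{r,t}$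 and $P(A)^{r,t}$ the operation $(\cdot)^{r,t}$ is applied to the length-$4n$ sequences $N(A)$ and $P(A)$, extended with period $4n$. Let $\psi:\mathbb{F}_{2^d}\to\{-1,1\}$ be the canonical additive character $\psi(y)=(-1)^{\mathrm{Tr}(y)}$, where $\mathrm{Tr}(y)=\sum_{j=0}^{d-1}y^{2^j}$ is the absolute trace. For $n=2^d-1$ and a primitive element $\theta$ of $\mathbb{F}_{2^d}$ (a generator of the multiplicative group), the Galois sequence of length $n$ with respect to $\theta$ is the coefficient sequence of $Y_{n,\theta}(z)=\sum_{j=0}^{n-1}\psi(\theta^j)z^j$. The function $h:\mathbb{R}^+\to\mathbb{R}$ is defined by $$\frac{1}{h(T)}=1-\frac{2T}{3}+4\sum_{m\in\mathbb{N}}\max\Big(0,1-\frac{m}{T}\Big)^2,$$ where $\mathbb{N}$ is the set of positive integers. *)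

theory Defs
  imports
    Complex_Main
    "HOL-Algebra.Multiplicative_Group"
    "HOL-Algebra.Generated_Groups"
    "HOL-Computational_Algebra.Polynomial"
begin

text \<open>
  A binary sequence is a list over $\{-1,1\}$ (type \<open>int list\<close>). It is identified with the
  polynomial having it as coefficient sequence; since no entry vanishes, \<^const>\<open>coeffs\<close> recovers
  exactly the sequence from the polynomial, including its length.
\<close>

definition autocorrelation :: "int list \<Rightarrow> nat \<Rightarrow> int" where
  "autocorrelation a u = (\<Sum>j<length a - u. a ! j * a ! (j + u))"

definition merit_factor :: "int list \<Rightarrow> real" where
  "merit_factor a =
     real (length a) ^ 2 / (2 * (\<Sum>u\<in>{1..<length a}. real_of_int (autocorrelation a u) ^ 2))"

definition poly_merit_factor :: "int poly \<Rightarrow> real" where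
  "poly_merit_factor A = merit_factor (coeffs A)"

definition poly_length :: "int poly \<Rightarrow> nat" where
  "poly_length A = length (coeffs A)"

definition periodic_coeff :: "int poly \<Rightarrow> int \<Rightarrow> int" where
  "periodic_coeff A j = Polynomial.coeff A (nat (j mod int (poly_length A)))"

text \<open>The polynomial $A^{r,t}$.\<close>

definition shift_poly :: "int poly \<Rightarrow> int \<Rightarrow> nat \<Rightarrow> int poly" where
  "shift_poly A r t = (\<Sum>j<t. Polynomial.monom (periodic_coeff A (int j + r)) j)"

text \<open>
  The polynomials $N(A)$ and $P(A)$. Both divisions by 2 are exact, and truncated subtraction
  at \<open>j = 0\<close> is harmless because of the factor \<open>j\<close>.
\<close>

definition N_poly :: "int poly \<Rightarrow> int poly" where
  "N_poly A = (\<Sum>j<4 * poly_length A.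
     Polynomial.monom ((-1) ^ (j * (j - 1) div 2) * periodic_coeff A (int j)) j)"

definition P_poly :: "int poly \<Rightarrow> int poly" where
  "P_poly A = (\<Sum>j<4 * poly_length A.
     Polynomial.monom ((-1) ^ (j * (j - 1) ^ 2 div 2) * periodic_coeff A (int j)) j)"

text \<open>
  In the following \<open>K\<close> is a field with $2^d$ elements. The trace takes values in the prime field
  \<open>{\<zero>, \<one>}\<close>, so $(-1)^{\mathrm{Tr}(y)}$ is 1 if the trace is \<open>\<zero>\<close> and $-1$ otherwise.
\<close>

definition abs_trace :: "('a, 'b) ring_scheme \<Rightarrow> nat \<Rightarrow> 'a \<Rightarrow> 'a" where
  "abs_trace K d y = finsum K (\<lambda>j. y [^]\<^bsub>K\<^esub> ((2::nat) ^ j)) {..<d}"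

definition add_char :: "('a, 'b) ring_scheme \<Rightarrow> nat \<Rightarrow> 'a \<Rightarrow> int" where
  "add_char K d y = (if abs_trace K d y = \<zero>\<^bsub>K\<^esub> then 1 else -1)"

definition primitive_element :: "('a, 'b) ring_scheme \<Rightarrow> 'a \<Rightarrow> bool" where
  "primitive_element K \<theta> \<longleftrightarrow>
     \<theta> \<in> carrier (mult_of K) \<and> generate (mult_of K) {\<theta>} = carrier (mult_of K)"

definition galois_poly :: "('a, 'b) ring_scheme \<Rightarrow> nat \<Rightarrow> 'a \<Rightarrow> int poly" where
  "galois_poly K d \<theta> = (\<Sum>j<2 ^ d - 1. Polynomial.monom (add_char K d (\<theta> [^]\<^bsub>K\<^esub> (j::nat))) j)"

text \<open>
  The limiting merit factor, for \<open>T > 0\<close>; the series over positive integers $m$ is indexed by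
  \<open>m = Suc k\<close>, and only finitely many of its terms are nonzero.
\<close>

definition h :: "real \<Rightarrow> real" where
  "h T = 1 / (1 - 2 * T / 3 + 4 * (\<Sum>k. (max 0 (1 - real (Suc k) / T)) ^ 2))"

end

theory Submission imports Defs "HOL-Real_Asymp.Real_Asymp" begin

text \<open>
  Write \<open>x\<^sub>j = \<psi>(\<theta>\<^sup>j)\<close>. In all three parts the sequence in question is a piece of length \<open>t\<close> of
  \<open>\<epsilon>\<^sub>j x\<^sub>j\<close> with signs \<open>\<epsilon>\<close> of period 4: constant for part (i), \<open>++--\<close> for \<open>N\<close> and \<open>++-+\<close> for \<open>P\<close>. What matters
  about \<open>\<epsilon>\<close> is a number \<open>q\<close>, equal to 1, 2 and 4 respectively: the products \<open>\<epsilon>\<^sub>j \<epsilon>\<^sub>j\<^sub>+\<^sub>u\<close> are constant in \<open>j\<close> if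
  \<open>q\<close> divides \<open>u\<close> and sum to zero over a period otherwise. So the sum \<open>E\<^sub>u\<close> of these products over
  \<open>j < t - u\<close> satisfies \<open>E\<^sub>u\<^sup>2 = (t - u)\<^sup>2\<close> in the first case and is bounded in the second.

  The reciprocal of the merit factor is \<open>2/t\<^sup>2\<close> times the sum of the \<open>c\<^sub>u\<^sup>2\<close>. If \<open>n\<close> divides \<open>u\<close>, then
  \<open>c\<^sub>u = E\<^sub>u\<close>. If not, \<open>x\<^sub>j x\<^sub>j\<^sub>+\<^sub>u = \<psi>(\<theta>\<^sup>j (1 + \<theta>\<^sup>u)) = x\<^sub>j\<^sub>+\<^sub>s\<^sub>(\<^sub>u\<^sub>)\<close>, where \<open>s\<close> is the Zech logarithm, and \<open>c\<^sub>u\<close> is a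
  signed window sum of \<open>x\<close> that starts at \<open>s(u)\<close>. The starting points \<open>s(u)\<close> are so irregular that, summed over
  \<open>u\<close>, each \<open>c\<^sub>u\<^sup>2\<close> may be replaced by its mean over all \<open>n\<close> starting points. This is
  \<open>windowed.discrepancy_le\<close>, the heart of the proof. By Fourier inversion modulo \<open>n\<close>, the difference is a sum
  over pairs of distinct frequencies of Gauss sums, geometric sums, and incomplete sums of
  \<open>\<omega>\<^sup>a\<^sup>u \<omega>\<^sup>-\<^sup>e\<^sup>s\<^sup>(\<^sup>u\<^sup>)\<close>. Shift-and-add alone shows that nontrivial Gauss sums have absolute value \<open>\<surd>(n+1)\<close> and that the
  complete sums of the last kind are quotients \<open>G\<^sub>a G\<^sub>e\<^sub>-\<^sub>a / G\<^sub>e\<close>, so they are at most \<open>\<surd>(n+1)\<close> as well. The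
  total error is of order \<open>n\<^sup>3\<^sup>/\<^sup>2 log\<^sup>3 n\<close>, while \<open>t\<^sup>2\<close> is of order \<open>n\<^sup>2\<close>.

  The mean itself is explicit, because the periodic autocorrelation of \<open>x\<close> takes only the values \<open>n\<close> and \<open>-1\<close>:
  it is \<open>(n+1)/n\<close> times the signed number of pairs of indices congruent modulo \<open>n\<close>, minus \<open>E\<^sub>u\<^sup>2/n\<close>. Summed over \<open>u\<close>,
  the pair counts collapse to \<open>E\<^sub>v\<^sup>2\<close> for the multiples \<open>v\<close> of \<open>n\<close>, and \<open>v = 0\<close> gives the leading 1 in \<open>1/h(T)\<close>
  (\<open>sign_pattern.sum_coincidences\<close>). All that
  remains are sums of \<open>(t - v)\<^sup>2\<close> over multiples of \<open>qn\<close>, which give the series in \<open>1/h(T)\<close> twice, and over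
  multiples of \<open>q\<close>, which give \<open>-2T/3\<close>. Since \<open>1/h(T)\<close> turns out to be positive (\<open>limit_value_pos\<close>), the
  reciprocals converge too.
\<close>

section \<open>Roots of unity and sums over residues\<close>

lemma sum_periodic_Suc:
  fixes f :: "int \<Rightarrow> 'a::ab_group_add"
  assumes "n > 0" "\<And>k. f (k + n) = f k"
  shows "(\<Sum>k\<in>{0..<n}. f (k + 1)) = (\<Sum>k\<in>{0..<n}. f k)"
proof -
  have "(\<Sum>k\<in>{0..<n}. f (k + 1)) = (\<Sum>k\<in>{1..<n+1}. f k)"
    by (rule sum.reindex_bij_witness[of _ "\<lambda>k. k - 1" "\<lambda>k. k + 1"]) auto
  also have "{1..<n+1} = insert n {1..<n}" using assms(1) by auto
  also have "(\<Sum>k\<in>insert n {1..<n}. f k) = f n + (\<Sum>k\<in>{1..<n}. f k)" by simp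
  also have "f n = f 0" using assms(2)[of 0] by simp
  also have "f 0 + (\<Sum>k\<in>{1..<n}. f k) = (\<Sum>k\<in>insert 0 {1..<n}. f k)" by simp
  also have "insert 0 {1..<n} = {0..<n}" using assms(1) by auto
  finally show ?thesis .
qed

lemma periodic_mult:
  fixes f :: "int \<Rightarrow> 'a"
  assumes "\<And>k. f (k + n) = f k"
  shows "f (k + m * n) = f k"
proof (induction m rule: int_induct[of _ 0])
  case (step1 i)
  have "f (k + (i + 1) * n) = f ((k + i * n) + n)" by (simp add: algebra_simps)
  then show ?case using step1 assms by simp
next
  case (step2 i)
  have "f (k + (i - 1) * n) = f ((k + (i - 1) * n) + n)" using assms by simp
  also have "\<dots> = f (k + i * n)" by (simp add: algebra_simps)
  finally show ?case using step2 by simp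
qed simp

lemma periodic_mod:
  fixes f :: "int \<Rightarrow> 'a"
  assumes "\<And>k. f (k + n) = f k"
  shows "f (k mod n) = f k"
  using periodic_mult[of f n "k mod n" "k div n", OF assms] by simp

lemma sum_periodic_bij:
  fixes f :: "int \<Rightarrow> 'a::ab_group_add"
  assumes n: "n > 0" and per: "\<And>k. f (k + n) = f k" and c: "coprime c n"
  shows "(\<Sum>k\<in>{0..<n}. f (c * k + a)) = (\<Sum>k\<in>{0..<n}. f k)"
proof -
  let ?g = "\<lambda>k. (c * k + a) mod n"
  have inj: "inj_on ?g {0..<n}"
  proof (rule inj_onI)
    fix k l assume kl: "k \<in> {0..<n}" "l \<in> {0..<n}" "?g k = ?g l"
    then have "n dvd (c * k + a) - (c * l + a)" by (metis mod_eq_dvd_iff)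
    then have "n dvd c * (k - l)" by (simp add: algebra_simps)
    then have "n dvd k - l" using c by (simp add: coprime_commute coprime_dvd_mult_right_iff)
    then have "k mod n = l mod n" by (simp add: mod_eq_dvd_iff)
    then show "k = l" using kl by auto
  qed
  have "?g ` {0..<n} \<subseteq> {0..<n}" using n by auto
  then have "?g ` {0..<n} = {0..<n}"
    using inj by (intro card_subset_eq) (auto simp: card_image)
  then have bij: "bij_betw ?g {0..<n} {0..<n}" using inj by (simp add: bij_betw_def)
  have "(\<Sum>k\<in>{0..<n}. f k) = (\<Sum>k\<in>{0..<n}. f (?g k))"
    using sum.reindex_bij_betw[OF bij, of f] by simp
  also have "\<dots> = (\<Sum>k\<in>{0..<n}. f (c * k + a))"
    using periodic_mod[of f n, OF per] by simp
  finally show ?thesis by simp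
qed

lemma sum_periodic_shift:
  fixes f :: "int \<Rightarrow> 'a::ab_group_add"
  assumes "n > 0" "\<And>k. f (k + n) = f k"
  shows "(\<Sum>k\<in>{0..<n}. f (k + a)) = (\<Sum>k\<in>{0..<n}. f k)"
  using sum_periodic_bij[of n f 1 a] assms by simp

definition unity :: "int \<Rightarrow> int \<Rightarrow> complex" where
  "unity n k = cis (2 * pi * of_int k / of_int n)"

lemma unity_add: "unity n (j + k) = unity n j * unity n k"
  by (simp add: unity_def cis_mult ring_distribs add_divide_distrib)

lemma norm_unity [simp]: "norm (unity n k) = 1"
  by (simp add: unity_def)

lemma unity_0 [simp]: "unity n 0 = 1"
  by (simp add: unity_def)

lemma cnj_unity [simp]: "cnj (unity n k) = unity n (- k)"
  by (simp add: unity_def cis_cnj)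

lemma unity_dvd: "n \<noteq> 0 \<Longrightarrow> n dvd k \<Longrightarrow> unity n k = 1"
  using cis_multiple_2pi[of "of_int (k div n)"]
  by (auto simp: unity_def dvd_def mult.assoc)

lemma unity_periodic [simp]: "n \<noteq> 0 \<Longrightarrow> unity n (k + n) = unity n k"
  by (simp add: unity_add unity_dvd)

lemma unity_cong: "n \<noteq> 0 \<Longrightarrow> n dvd j - k \<Longrightarrow> unity n j = unity n k"
  using unity_add[of n k "j - k"] by (simp add: unity_dvd)

lemma norm_unity_diff: "norm (1 - unity n k) = 2 * \<bar>sin (pi * of_int k / of_int n)\<bar>"
proof -
  let ?a = "pi * of_int k / of_int n"
  have e: "2 * pi * of_int k / of_int n = 2 * ?a" by simp
  have factor: "(2 * y ^ 2) ^ 2 + (2 * y * z) ^ 2 = 4 * y ^ 2 * (y ^ 2 + z ^ 2)" for y z :: real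
    by (simp add: power2_eq_square algebra_simps)
  have "norm (1 - unity n k)^2 = (1 - cos (2 * ?a))^2 + (sin (2 * ?a))^2"
    unfolding unity_def e cmod_power2 by simp
  also have "\<dots> = (2 * sin ?a ^ 2) ^ 2 + (2 * sin ?a * cos ?a) ^ 2"
    unfolding cos_double_sin sin_double by simp
  also have "\<dots> = 4 * sin ?a ^ 2 * (sin ?a ^ 2 + cos ?a ^ 2)"
    by (rule factor)
  also have "\<dots> = (2 * \<bar>sin ?a\<bar>)^2"
    by (simp only: sin_cos_squared_add power_mult_distrib power2_abs) simp
  finally show ?thesis
    by (smt (verit) abs_ge_zero norm_ge_zero power2_eq_iff_nonneg)
qed

text \<open>
  Jordan's inequality up to a constant.
\<close>
lemma third_le_sin:
  assumes "0 \<le> x" "x \<le> pi / 2"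
  shows "x / 3 \<le> sin x"
proof (cases "x \<le> pi / 3")
  case True
  have "(\<lambda>x. sin x - x / 3) 0 \<le> (\<lambda>x. sin x - x / 3) x"
  proof (rule DERIV_nonneg_imp_nondecreasing[OF assms(1)])
    fix y assume y: "0 \<le> y" "y \<le> x"
    have "cos (pi / 3) \<le> cos y"
      using y True by (intro cos_monotone_0_pi_le) auto
    then have "cos y - 1 / 3 \<ge> 0" by (simp add: cos_60)
    moreover have "((\<lambda>x. sin x - x / 3) has_real_derivative (cos y - 1/3)) (at y)"
      by (auto intro!: derivative_eq_intros)
    ultimately show "\<exists>z. ((\<lambda>x. sin x - x / 3) has_real_derivative z) (at y) \<and> 0 \<le> z" by blast
  qed
  then show ?thesis by simp
next
  case False
  have "sin (pi / 3) \<le> sin x"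
    using False assms by (intro sin_monotone_2pi_le) auto
  moreover have "sqrt 3 \<ge> 1.7" by (rule real_le_rsqrt) (simp add: power2_eq_square)
  moreover have "x / 3 \<le> 0.7" using assms pi_less_4 by simp
  ultimately show ?thesis by (simp add: sin_60)
qed

lemma unity_eq_1_iff:
  assumes "n > 0"
  shows "unity n k = 1 \<longleftrightarrow> n dvd k"
proof
  assume "unity n k = 1"
  then have "cos (2 * pi * of_int k / of_int n) = 1"
    by (metis cis.sel(1) one_complex.sel(1) unity_def)
  then obtain m :: int where "2 * pi * of_int k / of_int n = of_int m * (2 * pi)"
    by (auto simp: cos_one_2pi_int)
  then have "of_int k = (of_int (m * n) :: real)" using assms by (simp add: field_simps)
  then have "k = m * n" by (simp only: of_int_eq_iff)
  then show "n dvd k" by simp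
qed (use assms unity_dvd in auto)

text \<open>
  Shifting the summation index multiplies the sum by \<open>\<omega>\<^sup>m\<close>, so it vanishes unless this is 1.
\<close>
lemma sum_unity:
  assumes "n > 0"
  shows "(\<Sum>k\<in>{0..<n}. unity n (k * m)) = (if n dvd m then of_int n else 0)"
proof (cases "n dvd m")
  case True
  then have "unity n (k * m) = 1" for k using assms by (intro unity_dvd) auto
  then show ?thesis using True assms by simp
next
  case False
  let ?S = "\<Sum>k\<in>{0..<n}. unity n (k * m)"
  have "?S = (\<Sum>k\<in>{0..<n}. unity n ((k + 1) * m))"
  proof (rule sum_periodic_Suc[OF assms, symmetric])
    show "unity n ((k + n) * m) = unity n (k * m)" for k
      using assms by (intro unity_cong) (auto simp: algebra_simps)
  qed
  also have "\<dots> = unity n m * ?S"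
    by (simp add: sum_distrib_left ring_distribs unity_add mult.commute)
  finally have "(1 - unity n m) * ?S = 0" by (simp add: algebra_simps)
  moreover have "unity n m \<noteq> 1" using False assms by (simp add: unity_eq_1_iff)
  ultimately show ?thesis using False by simp
qed

lemma sum_unity':
  assumes "n > 0"
  shows "(\<Sum>k\<in>{0..<n}. unity n (m * k)) = (if n dvd m then of_int n else 0)"
  using sum_unity[OF assms, of m] by (simp add: mult.commute)

lemma norm_one_minus_unity_ge:
  assumes "1 \<le> v" "v < n"
  shows "norm (1 - unity n v) \<ge> real_of_int (min v (n - v)) / n"
proof -
  have *: "norm (1 - unity n v) \<ge> v / n" if v: "1 \<le> v" "2 * v \<le> n" for v
  proof -
    let ?x = "pi * of_int v / of_int n :: real"
    have "?x \<le> pi / 2" using v by (simp add: field_simps)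
    then have "?x / 3 \<le> sin ?x" using v by (intro third_le_sin) auto
    moreover have "v / n \<le> 2 * (?x / 3)"
      using v pi_ge_two by (auto simp: field_simps)
    ultimately show ?thesis unfolding norm_unity_diff by linarith
  qed
  show ?thesis
  proof (cases "2 * v \<le> n")
    case True
    then show ?thesis using *[of v] assms by simp
  next
    case False
    have "1 - unity n v = 1 - cnj (unity n (n - v))"
      using assms unity_periodic[of n "-v"] by (simp add: algebra_simps)
    then have "norm (1 - unity n v) = norm (1 - unity n (n - v))"
      by (metis complex_cnj_diff complex_cnj_one complex_mod_cnj)
    then show ?thesis using *[of "n - v"] assms False by simp
  qed
qed

lemma sum_inverse_le_ln:
  assumes "m \<ge> 1"
  shows "(\<Sum>k\<in>{1..m}. 1 / real_of_int k) \<le> 1 + ln m"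
  using assms
proof (induction m rule: int_ge_induct)
  case (step m)
  have "{1..m + 1} = insert (m + 1) {1..m}" using step by auto
  then have "(\<Sum>k\<in>{1..m+1}. 1 / real_of_int k) = 1 / (m + 1) + (\<Sum>k\<in>{1..m}. 1 / real_of_int k)"
    by simp
  also have "\<dots> \<le> 1 / (m + 1) + 1 + ln m" using step by simp
  also have "ln (real_of_int m / (m + 1)) \<le> real_of_int m / (m + 1) - 1"
    using step by (intro ln_le_minus_one) auto
  then have "1 / (m + 1) + 1 + ln m \<le> 1 + ln (m + 1)"
    using step by (simp add: ln_div field_simps)
  finally show ?case by simp
qed simp

text \<open>
  This is the source of every logarithm in the error term: the gap \<open>|1 - \<omega>\<^sup>v|\<close> is at least the distance of
  \<open>v\<close> from the multiples of \<open>n\<close>, divided by \<open>n\<close>, so the sum is comparable to \<open>n\<close> times a harmonic sum.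
\<close>
lemma sum_inverse_one_minus_unity_le:
  assumes "n \<ge> 2"
  shows "(\<Sum>v\<in>{1..<n}. 1 / norm (1 - unity n v)) \<le> 2 * real_of_int n * (1 + ln (real_of_int n))"
proof -
  have "1 / norm (1 - unity n v) \<le> n * (1 / real_of_int v) + n * (1 / real_of_int (n - v))"
    if "v \<in> {1..<n}" for v
  proof -
    have pos: "0 < real_of_int (min v (n - v)) / n" using that by simp
    have le: "real_of_int (min v (n - v)) / n \<le> norm (1 - unity n v)"
      using that norm_one_minus_unity_ge[of v n] by simp
    have "1 / norm (1 - unity n v) \<le> 1 / (min v (n - v) / n)"
      using pos le order.strict_trans2[OF pos le] by (intro divide_left_mono mult_pos_pos) auto
    also have "\<dots> = n * (1 / min v (n - v))" by simp
    also have "\<dots> \<le> n * (1 / real_of_int v) + n * (1 / real_of_int (n - v))"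
      using that by (auto simp: min_def)
    finally show ?thesis .
  qed
  then have "(\<Sum>v\<in>{1..<n}. 1 / norm (1 - unity n v))
      \<le> (\<Sum>v\<in>{1..<n}. n * (1 / real_of_int v) + n * (1 / real_of_int (n - v)))"
    by (rule sum_mono)
  also have "\<dots> = n * (\<Sum>v\<in>{1..<n}. 1 / real_of_int v) + n * (\<Sum>v\<in>{1..<n}. 1 / real_of_int (n - v))"
    by (simp add: sum.distrib sum_distrib_left)
  also have "(\<Sum>v\<in>{1..<n}. 1 / real_of_int (n - v)) = (\<Sum>v\<in>{1..<n}. 1 / real_of_int v)"
    by (rule sum.reindex_bij_witness[of _ "\<lambda>v. n - v" "\<lambda>v. n - v"]) auto
  also have "(\<Sum>v\<in>{1..<n}. 1 / real_of_int v) \<le> (\<Sum>v\<in>{1..n}. 1 / real_of_int v)"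
    by (rule sum_mono2) auto
  also have "\<dots> \<le> 1 + ln n" using assms by (intro sum_inverse_le_ln) auto
  finally show ?thesis using assms by (simp add: algebra_simps mult_left_mono)
qed

section \<open>Gauss and Jacobi sums from shift-and-add\<close>

text \<open>
  The only facts about Galois sequences that the analytic part uses; \<open>s\<close> is the Zech logarithm. It is
  undefined at multiples \<open>u\<close> of \<open>n\<close>, where \<open>1 + \<theta>\<^sup>u = 0\<close>.
\<close>
locale shift_and_add =
  fixes n :: int and x :: "int \<Rightarrow> real" and s :: "int \<Rightarrow> int"
  assumes n_ge: "n \<ge> 2" and odd_n: "odd n"
    and x_periodic: "x (k + n) = x k"
    and x_square: "x k * x k = 1"
    and x_mult: "\<not> n dvd u \<Longrightarrow> x j * x (j + u) = x (j + s u)"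
    and s_periodic: "s (u + n) = s u"
    and x_sum: "(\<Sum>k\<in>{0..<n}. x k) = - 1"
begin

lemma n_pos: "n > 0" and n_nz: "n \<noteq> 0" using n_ge by auto

lemma x_dvd: "n dvd u \<Longrightarrow> x (k + u) = x k"
  using periodic_mult[of x n k "u div n", OF x_periodic] by (auto simp: mult.commute)

lemma x_mult_dvd: "n dvd u \<Longrightarrow> x j * x (j + u) = 1"
  by (simp add: x_dvd x_square)

lemma x_correlation: "(\<Sum>k\<in>{0..<n}. x k * x (k + u)) = (if n dvd u then of_int n else - 1)"
proof (cases "n dvd u")
  case True
  then show ?thesis using n_pos by (simp add: x_mult_dvd)
next
  case False
  have "(\<Sum>k\<in>{0..<n}. x k * x (k + u)) = (\<Sum>k\<in>{0..<n}. x (k + s u))"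
    by (simp only: x_mult[OF False])
  also have "\<dots> = - 1"
    using sum_periodic_shift[of n x "s u", OF n_pos x_periodic] x_sum by simp
  finally show ?thesis using False by simp
qed

definition gauss_sum :: "int \<Rightarrow> complex" where
  "gauss_sum b = (\<Sum>k\<in>{0..<n}. of_real (x k) * unity n (b * k))"

lemma unity_mult_periodic: "unity n (b * (k + n)) = unity n (b * k)"
  by (rule unity_cong[OF n_nz]) (simp add: algebra_simps)

lemma gauss_sum_0: "gauss_sum 0 = - 1"
  unfolding gauss_sum_def using x_sum by (simp flip: of_real_sum)

lemma gauss_sum_shift: "(\<Sum>k\<in>{0..<n}. of_real (x (k + u)) * unity n (b * (k + u))) = gauss_sum b"
  unfolding gauss_sum_def
  by (rule sum_periodic_shift[OF n_pos, of "\<lambda>k. of_real (x k) * unity n (b * k)"])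
     (simp add: x_periodic unity_mult_periodic)

text \<open>
  The square is the Fourier transform of the periodic autocorrelation, which is \<open>n + 1\<close> at 0 minus
  the constant 1.
\<close>
lemma norm_gauss_sum_sq:
  assumes "\<not> n dvd b"
  shows "norm (gauss_sum b) ^ 2 = n + 1"
proof -
  have "complex_of_real (norm (gauss_sum b) ^ 2) = gauss_sum b * cnj (gauss_sum b)"
    by (rule complex_norm_square)
  also have "cnj (gauss_sum b) = (\<Sum>j\<in>{0..<n}. of_real (x j) * unity n (- (b * j)))"
    by (simp add: gauss_sum_def)
  also have "gauss_sum b * \<dots> = (\<Sum>j\<in>{0..<n}. gauss_sum b * (of_real (x j) * unity n (- (b * j))))"
    by (simp add: sum_distrib_left)
  also have "\<dots> = (\<Sum>j\<in>{0..<n}. (\<Sum>u\<in>{0..<n}. of_real (x (u + j)) * unity n (b * (u + j)))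
      * (of_real (x j) * unity n (- (b * j))))"
    by (simp only: gauss_sum_shift)
  also have "\<dots> = (\<Sum>j\<in>{0..<n}. \<Sum>u\<in>{0..<n}. unity n (b * u) * of_real (x j * x (j + u)))"
  proof (intro sum.cong refl)
    fix j
    have cancel: "unity n (b * u) = unity n (b * (u + j)) * unity n (- (b * j))" for u
      by (simp add: ring_distribs flip: unity_add)
    show "(\<Sum>u\<in>{0..<n}. of_real (x (u + j)) * unity n (b * (u + j))) * (of_real (x j) * unity n (- (b * j)))
        = (\<Sum>u\<in>{0..<n}. unity n (b * u) * of_real (x j * x (j + u)))"
      unfolding sum_distrib_right
    proof (intro sum.cong refl)
      fix u
      show "of_real (x (u + j)) * unity n (b * (u + j)) * (of_real (x j) * unity n (- (b * j))) =
          unity n (b * u) * of_real (x j * x (j + u))"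
        unfolding cancel[of u] of_real_mult add.commute[of j u] by (simp only: mult_ac)
    qed
  qed
  also have "\<dots> = (\<Sum>u\<in>{0..<n}. unity n (b * u) * of_real (\<Sum>j\<in>{0..<n}. x j * x (j + u)))"
    by (subst sum.swap) (simp add: sum_distrib_left)
  also have "\<dots> = (\<Sum>u\<in>{0..<n}. (if u = 0 then of_int n + 1 else 0) - unity n (b * u))"
    unfolding x_correlation by (intro sum.cong) (auto dest: zdvd_imp_le)
  also have "\<dots> = of_int n + 1"
    using assms n_pos by (simp add: sum_subtractf sum_unity')
  finally have "complex_of_real (norm (gauss_sum b) ^ 2) = complex_of_real (n + 1)" by simp
  then show ?thesis by (simp only: of_real_eq_iff)
qed

lemma norm_gauss_sum:
  assumes "\<not> n dvd b"
  shows "norm (gauss_sum b) = sqrt (n + 1)"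
  using norm_gauss_sum_sq[OF assms] n_pos by (metis norm_ge_zero real_sqrt_unique)

lemma gauss_sum_periodic: "gauss_sum (b + n) = gauss_sum b"
  unfolding gauss_sum_def by (intro sum.cong refl arg_cong2[where f="(*)"] unity_cong[OF n_nz])
    (simp add: algebra_simps)

lemma norm_gauss_sum_le: "norm (gauss_sum b) \<le> sqrt (n + 1)"
proof (cases "n dvd b")
  case True
  then have "gauss_sum b = - 1"
    using periodic_mult[of gauss_sum n 0 "b div n", OF gauss_sum_periodic] gauss_sum_0 by simp
  then show ?thesis using n_pos by simp
qed (simp add: norm_gauss_sum)

lemma fourier_inversion:
  fixes f :: "int \<Rightarrow> complex"
  assumes per: "\<And>k. f (k + n) = f k"
  shows "of_int n * f m = (\<Sum>b\<in>{0..<n}. (\<Sum>k\<in>{0..<n}. f k * unity n (b * k)) * unity n (- (b * m)))"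
proof -
  have "(\<Sum>b\<in>{0..<n}. (\<Sum>k\<in>{0..<n}. f k * unity n (b * k)) * unity n (- (b * m)))
      = (\<Sum>k\<in>{0..<n}. \<Sum>b\<in>{0..<n}. f k * unity n (b * (k - m)))"
    by (subst sum.swap) (simp add: sum_distrib_right ring_distribs unity_add[symmetric] mult.assoc)
  also have "\<dots> = (\<Sum>k\<in>{0..<n}. f k * (if n dvd (k - m) then of_int n else 0))"
    by (simp add: sum_distrib_left[symmetric] sum_unity n_pos)
  also have "\<dots> = (\<Sum>k\<in>{0..<n}. if k = m mod n then f k * of_int n else 0)"
    by (intro sum.cong) (auto simp: mod_eq_dvd_iff[symmetric])
  also have "\<dots> = f (m mod n) * of_int n"
    using n_pos by simp
  also have "f (m mod n) = f m" by (rule periodic_mod[of f, OF per])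
  finally show ?thesis by (simp add: mult.commute)
qed

text \<open>
  The phase \<open>\<omega>\<^sup>-\<^sup>e\<^sup>s\<^sup>(\<^sup>u\<^sup>)\<close> of the starting point \<open>s(u)\<close>, set to 0 where the Zech logarithm is undefined.
\<close>
definition shift_phase :: "int \<Rightarrow> int \<Rightarrow> complex" where
  "shift_phase e u = (if n dvd u then 0 else unity n (- (e * s u)))"

lemma shift_phase_periodic: "shift_phase e (u + n) = shift_phase e u"
  by (simp add: shift_phase_def s_periodic)

lemma norm_shift_phase_le: "norm (shift_phase e u) \<le> 1"
  by (simp add: shift_phase_def)

text \<open>
  The Jacobi sum identity. Multiplied by \<open>G\<^sub>e\<close>, the phase \<open>\<omega>\<^sup>-\<^sup>e\<^sup>s\<^sup>(\<^sup>u\<^sup>)\<close> turns into the transform of the sequence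
  shifted by \<open>s(u)\<close>, that is, of \<open>x\<^sub>j x\<^sub>j\<^sub>+\<^sub>u\<close>; the double sum over \<open>j\<close> and \<open>j + u\<close> then factors. The indices
  \<open>u\<close> divisible by \<open>n\<close> contribute nothing because \<open>\<omega>\<^sup>e \<noteq> 1\<close>.
\<close>
lemma jacobi_mult:
  assumes "\<not> n dvd e"
  shows "(\<Sum>u\<in>{0..<n}. shift_phase e u * unity n (a * u)) * gauss_sum e = gauss_sum a * gauss_sum (e - a)"
proof -
  have key: "shift_phase e u * gauss_sum e = (\<Sum>j\<in>{0..<n}. unity n (e * j) * of_real (x j * x (j + u)))" for u
  proof (cases "n dvd u")
    case True
    then have "(\<Sum>j\<in>{0..<n}. unity n (e * j) * of_real (x j * x (j + u))) = (\<Sum>j\<in>{0..<n}. unity n (e * j))"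
      by (simp add: x_mult_dvd del: of_real_mult)
    then show ?thesis using True assms n_pos by (simp add: sum_unity' shift_phase_def)
  next
    case False
    have "shift_phase e u * gauss_sum e = unity n (- (e * s u)) *
        (\<Sum>k\<in>{0..<n}. of_real (x (k + s u)) * unity n (e * (k + s u)))"
      using False by (simp add: shift_phase_def gauss_sum_shift)
    also have "\<dots> = (\<Sum>k\<in>{0..<n}. of_real (x (k + s u)) * unity n (e * k))"
      by (simp add: sum_distrib_left mult.left_commute unity_add[symmetric] ring_distribs)
    also have "\<dots> = (\<Sum>j\<in>{0..<n}. unity n (e * j) * of_real (x j * x (j + u)))"
      using False by (simp add: x_mult mult.commute del: of_real_mult)
    finally show ?thesis .
  qed
  have "(\<Sum>u\<in>{0..<n}. shift_phase e u * unity n (a * u)) * gauss_sum e =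
      (\<Sum>u\<in>{0..<n}. \<Sum>j\<in>{0..<n}. unity n (a * u) * (unity n (e * j) * of_real (x j * x (j + u))))"
    unfolding sum_distrib_right sum_distrib_left[symmetric] key[symmetric] by (simp only: mult_ac)
  also have "\<dots> = (\<Sum>j\<in>{0..<n}. of_real (x j) * unity n ((e - a) * j) *
      (\<Sum>u\<in>{0..<n}. of_real (x (u + j)) * unity n (a * (u + j))))"
    by (subst sum.swap, unfold sum_distrib_left, intro sum.cong refl)
       (simp add: ring_distribs unity_add add.commute mult_ac left_diff_distrib
         unity_add[of n "e * _" "- (a * _)", simplified],
        simp add: mult.assoc[symmetric] flip: unity_add)
  also have "\<dots> = gauss_sum a * gauss_sum (e - a)"
    by (simp only: gauss_sum_shift) (simp add: gauss_sum_def[of "e - a"] sum_distrib_left mult.commute)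
  finally show ?thesis .
qed

lemma norm_jacobi_le:
  assumes "\<not> n dvd e"
  shows "norm (\<Sum>u\<in>{0..<n}. shift_phase e u * unity n (a * u)) \<le> sqrt (n + 1)"
proof -
  let ?J = "\<Sum>u\<in>{0..<n}. shift_phase e u * unity n (a * u)"
  have "norm ?J * sqrt (n + 1) = norm (?J * gauss_sum e)"
    by (simp add: norm_mult norm_gauss_sum[OF assms])
  also have "\<dots> \<le> sqrt (n + 1) * sqrt (n + 1)"
    unfolding jacobi_mult[OF assms] norm_mult using n_pos by (intro mult_mono norm_gauss_sum_le) auto
  finally show ?thesis by (rule mult_right_le_imp_le) (use n_pos in simp)
qed

definition inv_sum :: real where
  "inv_sum = (\<Sum>v\<in>{1..<n}. 1 / norm (1 - unity n v))"

lemma inv_sum_le: "inv_sum \<le> 2 * real_of_int n * (1 + ln (real_of_int n))"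
  unfolding inv_sum_def by (rule sum_inverse_one_minus_unity_le[OF n_ge])

lemma inv_sum_nonneg: "inv_sum \<ge> 0"
  unfolding inv_sum_def by (intro sum_nonneg) auto

definition inverse_gap :: "int \<Rightarrow> real" where
  "inverse_gap v = 1 / norm (1 - unity n (4 * v))"

lemma inverse_gap_nonneg: "inverse_gap v \<ge> 0"
  by (simp add: inverse_gap_def)

lemma inverse_gap_0: "inverse_gap 0 = 0"
  by (simp add: inverse_gap_def)

lemma sum_split_0: "(\<Sum>v\<in>{0..<n}. f v) = f 0 + (\<Sum>v\<in>{1..<n}. f v)"
  for f :: "int \<Rightarrow> 'b::comm_monoid_add"
proof -
  have "{0..<n} = insert 0 {1..<n}" using n_pos by auto
  then show ?thesis by simp
qed

text \<open>
  Multiplication by 4 permutes the residues modulo the odd number \<open>n\<close>. The term at 0 vanishes by the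
  convention for division by zero.
\<close>
lemma sum_inverse_gap: "(\<Sum>v\<in>{0..<n}. inverse_gap v) = inv_sum"
proof -
  have "coprime (4 :: int) n"
    using odd_n coprime_power_left_iff[of 2 2 n] by (simp add: coprime_left_2_iff_odd)
  moreover have "1 / norm (1 - unity n (k + n)) = 1 / norm (1 - unity n k)" for k
    using n_nz by simp
  ultimately have "(\<Sum>v\<in>{0..<n}. 1 / norm (1 - unity n (4 * v + 0)))
      = (\<Sum>v\<in>{0..<n}. 1 / norm (1 - unity n v))"
    using n_pos by (intro sum_periodic_bij[where f="\<lambda>v. 1 / norm (1 - unity n v)"])
  then show ?thesis by (simp add: inverse_gap_def inv_sum_def sum_split_0)
qed

text \<open>
  Multiplying by \<open>1 - \<omega>\<^sup>4\<^sup>v\<close> telescopes sums over residue classes modulo 4 and sums with weights of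
  period 4; this divides the factor out again. It does not vanish since \<open>n\<close> is odd.
\<close>
lemma inverse_gap_mult: "\<not> n dvd v \<Longrightarrow> norm ((1 - unity n (4 * v)) * z) \<le> C \<Longrightarrow> norm z \<le> C * inverse_gap v"
proof -
  assume v: "\<not> n dvd v" and le: "norm ((1 - unity n (4 * v)) * z) \<le> C"
  have "coprime n (4::int)"
    using odd_n coprime_power_right_iff[of n 2 2] by (simp add: coprime_right_2_iff_odd)
  then have "\<not> n dvd 4 * v" using v by (simp add: coprime_dvd_mult_right_iff)
  then have "norm (1 - unity n (4 * v)) > 0" using n_pos by (simp add: unity_eq_1_iff eq_commute[of 1])
  moreover have "norm z * norm (1 - unity n (4 * v)) \<le> C"
    using le by (simp only: norm_mult mult.commute)
  ultimately show "norm z \<le> C * inverse_gap v"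
    by (simp add: inverse_gap_def pos_le_divide_eq)
qed

text \<open>
  Completion: a sum over \<open>U\<close> of an \<open>n\<close>-periodic function is a combination of its complete twisted sums, with the
  exponential sums over \<open>U\<close> as coefficients, and these are small away from frequency 0.
\<close>
lemma incomplete_sum_le:
  fixes f :: "int \<Rightarrow> complex"
  assumes per: "\<And>k. f (k + n) = f k"
    and B: "\<And>v. norm (\<Sum>k\<in>{0..<n}. f k * unity n (v * k)) \<le> B"
    and U: "real (card U) \<le> t"
      "\<And>v. \<not> n dvd v \<Longrightarrow> norm (\<Sum>u\<in>U. unity n (v * u)) \<le> 2 * inverse_gap v"
  shows "norm (\<Sum>u\<in>U. f u) \<le> B * (t + 2 * inv_sum) / n"
proof -
  let ?F = "\<lambda>v. \<Sum>k\<in>{0..<n}. f k * unity n (v * k)"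
  have "B \<ge> 0" using B[of 0] norm_ge_zero order.trans by blast
  have inverse_gap_minus: "inverse_gap (- v) = inverse_gap v" for v
    unfolding inverse_gap_def using complex_mod_cnj[of "1 - unity n (4 * v)"] by simp
  have "of_int n * (\<Sum>u\<in>U. f u) = (\<Sum>u\<in>U. \<Sum>v\<in>{0..<n}. ?F v * unity n (- (v * u)))"
    by (simp add: sum_distrib_left fourier_inversion[of f, OF per])
  also have "\<dots> = (\<Sum>v\<in>{0..<n}. ?F v * (\<Sum>u\<in>U. unity n (- (v * u))))"
    by (subst sum.swap) (simp add: sum_distrib_left)
  finally have "of_int n * norm (\<Sum>u\<in>U. f u) = norm (\<Sum>v\<in>{0..<n}. ?F v * (\<Sum>u\<in>U. unity n (- (v * u))))"
    using n_pos by (metis abs_of_nonneg norm_mult norm_of_int of_int_0_le_iff order_less_imp_le)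
  also have "\<dots> \<le> (\<Sum>v\<in>{0..<n}. B * ((if v = 0 then t else 0) + 2 * inverse_gap v))"
  proof (rule sum_norm_le)
    fix v assume v: "v \<in> {0..<n}"
    have "norm (\<Sum>u\<in>U. unity n (- (v * u))) \<le> (if v = 0 then t else 0) + 2 * inverse_gap v"
    proof (cases "v = 0")
      case True
      then show ?thesis using U(1) by (simp add: inverse_gap_0)
    next
      case False
      then have "\<not> n dvd - v" using v by (auto dest: zdvd_imp_le)
      then show ?thesis using U(2)[of "- v"] False inverse_gap_minus by simp
    qed
    then show "norm (?F v * (\<Sum>u\<in>U. unity n (- (v * u)))) \<le> B * ((if v = 0 then t else 0) + 2 * inverse_gap v)"
      unfolding norm_mult using B \<open>B \<ge> 0\<close> by (intro mult_mono) auto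
  qed
  also have "\<dots> = B * (t + 2 * inv_sum)"
    using n_pos by (simp add: sum_distrib_left[symmetric] sum.distrib sum_inverse_gap)
  finally show ?thesis using n_pos by (simp add: field_simps)
qed

end

text \<open>
  The two sums on the right may overlap; the common terms cancel.
\<close>
lemma telescope_4:
  fixes \<phi> :: "int \<Rightarrow> 'a::ab_group_add"
  assumes "a \<le> b"
  shows "(\<Sum>u\<in>{a..<b}. \<phi> u - \<phi> (u + 4)) = (\<Sum>u\<in>{a..<a+4}. \<phi> u) - (\<Sum>u\<in>{b..<b+4}. \<phi> u)"
  using assms
proof (induction b rule: int_ge_induct)
  case (step b)
  have "{a..<b+1} = insert b {a..<b}" using step by auto
  moreover have "{b..<b+4} = insert b {b+1..<b+4}" by auto
  moreover have "{b+1..<b+1+4} = insert (b+4) {b+1..<b+4}" by auto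
  ultimately show ?case using step by (simp add: algebra_simps)
qed simp

lemma sum_4: "(\<Sum>u\<in>{b..<b+4}. \<phi> u) = \<phi> b + \<phi> (b+1) + \<phi> (b+2) + \<phi> (b+3)"
  for \<phi> :: "int \<Rightarrow> 'a::ab_group_add"
proof -
  have "{b..<b+4} = {b, b+1, b+2, b+3}" by auto
  then show ?thesis by (simp add: add.assoc)
qed

definition residue_class :: "int \<Rightarrow> int \<Rightarrow> int set" where
  "residue_class t \<rho> = {u \<in> {1..<t}. u mod 4 = \<rho>}"

lemma (in shift_and_add) residue_class_unity_le:
  assumes v: "\<not> n dvd v" and t: "t \<ge> 1"
  shows "norm (\<Sum>u\<in>residue_class t \<rho>. unity n (v * u)) \<le> 2 * inverse_gap v"
proof (rule inverse_gap_mult[OF v])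
  define \<phi> where "\<phi> = (\<lambda>u. if u mod 4 = \<rho> then unity n (v * u) else 0)"
  have shift: "\<phi> (u + 4) = unity n (4 * v) * \<phi> u" for u
  proof -
    have "v * (u + 4) = 4 * v + v * u" by (simp add: algebra_simps)
    then show ?thesis by (simp only: \<phi>_def unity_add mod_add_self2) simp
  qed
  have "(\<Sum>u\<in>residue_class t \<rho>. unity n (v * u)) = (\<Sum>u\<in>{1..<t}. \<phi> u)"
    unfolding residue_class_def \<phi>_def by (rule sum.inter_filter) simp
  also have "(1 - unity n (4 * v)) * \<dots> = (\<Sum>u\<in>{1..<t}. \<phi> u - \<phi> (u + 4))"
    unfolding sum_distrib_left by (simp only: shift left_diff_distrib mult_1_left)
  also have "\<dots> = (\<Sum>u\<in>{1..<1+4}. \<phi> u) - (\<Sum>u\<in>{t..<t+4}. \<phi> u)"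
    using t by (rule telescope_4)
  finally have eq: "(1 - unity n (4 * v)) * (\<Sum>u\<in>residue_class t \<rho>. unity n (v * u)) =
    (\<Sum>u\<in>{1..<1+4}. \<phi> u) - (\<Sum>u\<in>{t..<t+4}. \<phi> u)" .
  have le1: "norm (\<Sum>u\<in>{b..<b+4}. \<phi> u) \<le> 1" for b
  proof -
    have "norm (\<Sum>u\<in>{b..<b+4}. \<phi> u) \<le> (\<Sum>u\<in>{b..<b+4}. if u mod 4 = \<rho> then 1 else 0)"
      by (rule sum_norm_le) (simp add: \<phi>_def)
    also have "\<dots> \<le> (1::real)"
    proof -
      have ne: "(b + i) mod 4 \<noteq> (b + j) mod 4" if "0 \<le> i" "i < j" "j < 4" for i j :: int
        using that by (simp add: mod_eq_dvd_iff) presburger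
      show ?thesis
        unfolding sum_4 using ne[of 0 1] ne[of 0 2] ne[of 0 3] ne[of 1 2] ne[of 1 3] ne[of 2 3]
        by auto
    qed
    finally show ?thesis .
  qed
  show "norm ((1 - unity n (4 * v)) * (\<Sum>u\<in>residue_class t \<rho>. unity n (v * u))) \<le> 2"
    unfolding eq using norm_triangle_ineq4[of "\<Sum>u\<in>{1..<1+4}. \<phi> u" "\<Sum>u\<in>{t..<t+4}. \<phi> u"]
      le1[of 1] le1[of t] by linarith
qed

section \<open>Equidistribution of the starting points of window sums\<close>

text \<open>
  The weights \<open>e\<close> stand for the sign products \<open>\<epsilon>\<^sub>j \<epsilon>\<^sub>j\<^sub>+\<^sub>u\<close>, which depend on \<open>u\<close> only through its residue
  \<open>\<rho>\<close> modulo 4.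
\<close>
locale windowed = shift_and_add +
  fixes e :: "int \<Rightarrow> real" and t :: int and \<rho> :: int
  assumes e_periodic: "e (k + 4) = e k" and e_le: "\<bar>e k\<bar> \<le> 1" and t_pos: "t \<ge> 1"
begin

definition window :: "int \<Rightarrow> int \<Rightarrow> real" where
  "window u m = (\<Sum>j\<in>{0..<t-u}. e j * x (j + m))"

definition mean_square :: "int \<Rightarrow> real" where
  "mean_square u = (\<Sum>m\<in>{0..<n}. window u m ^ 2) / n"

definition dirichlet :: "int \<Rightarrow> int \<Rightarrow> complex" where
  "dirichlet b L = (\<Sum>j\<in>{0..<L}. of_real (e j) * unity n (- (b * j)))"

lemma window_fourier:
  "of_int n * of_real (window u m) = (\<Sum>b\<in>{0..<n}. gauss_sum b * dirichlet b (t - u) * unity n (- (b * m)))"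
proof -
  have inv: "of_int n * of_real (x k) = (\<Sum>b\<in>{0..<n}. gauss_sum b * unity n (- (b * k)))" for k
    unfolding gauss_sum_def using fourier_inversion[of "\<lambda>k. of_real (x k)" k] by (simp add: x_periodic)
  have "of_int n * complex_of_real (window u m) =
      (\<Sum>j\<in>{0..<t-u}. of_real (e j) * (of_int n * of_real (x (j + m))))"
    unfolding window_def by (simp add: sum_distrib_left mult_ac)
  also have "\<dots> = (\<Sum>j\<in>{0..<t-u}. \<Sum>b\<in>{0..<n}. gauss_sum b * (of_real (e j) * unity n (- (b * j))) * unity n (- (b * m)))"
    unfolding inv sum_distrib_left
    by (intro sum.cong refl) (simp add: ring_distribs mult_ac flip: unity_add)
  also have "\<dots> = (\<Sum>b\<in>{0..<n}. gauss_sum b * dirichlet b (t - u) * unity n (- (b * m)))"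
    by (subst sum.swap) (simp add: dirichlet_def sum_distrib_left sum_distrib_right)
  finally show ?thesis .
qed

definition pair_coeff :: "int \<Rightarrow> int \<Rightarrow> int \<Rightarrow> complex" where
  "pair_coeff b c u = gauss_sum b * cnj (gauss_sum c) * (dirichlet b (t - u) * cnj (dirichlet c (t - u)))"

text \<open>
  Since the window sum is real, its square may be expanded as itself times its conjugate; the starting
  point then enters only through the difference of the two frequencies.
\<close>
lemma window_sq_fourier:
  "of_int n ^ 2 * of_real (window u m ^ 2) =
     (\<Sum>b\<in>{0..<n}. \<Sum>c\<in>{0..<n}. pair_coeff b c u * unity n (- ((b - c) * m)))"
proof -
  let ?W = "complex_of_real (window u m)"
  have "of_int n ^ 2 * complex_of_real (window u m ^ 2) = (of_int n * ?W) * cnj (of_int n * ?W)"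
    by (simp add: power2_eq_square)
  also have "\<dots> = (\<Sum>b\<in>{0..<n}. \<Sum>c\<in>{0..<n}. pair_coeff b c u * (unity n (- (b * m)) * unity n (c * m)))"
    unfolding window_fourier cnj_sum sum_product
    by (intro sum.cong refl) (simp add: pair_coeff_def mult_ac)
  also have "\<dots> = (\<Sum>b\<in>{0..<n}. \<Sum>c\<in>{0..<n}. pair_coeff b c u * unity n (- ((b - c) * m)))"
    unfolding unity_add[symmetric] by (simp add: algebra_simps)
  finally show ?thesis .
qed

text \<open>
  Averaging over the starting point kills all pairs of different frequencies, so the mean square is the
  diagonal part of the expansion.
\<close>
lemma mean_square_fourier:
  "of_int n ^ 2 * complex_of_real (mean_square u) = (\<Sum>b\<in>{0..<n}. pair_coeff b b u)"
proof -
  have "of_int n * (of_int n ^ 2 * complex_of_real (mean_square u)) =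
      (\<Sum>m\<in>{0..<n}. of_int n ^ 2 * complex_of_real (window u m ^ 2))"
    using n_nz by (simp add: mean_square_def sum_distrib_left[symmetric])
  also have "\<dots> = (\<Sum>b\<in>{0..<n}. \<Sum>c\<in>{0..<n}. pair_coeff b c u * (\<Sum>m\<in>{0..<n}. unity n ((c - b) * m)))"
    unfolding window_sq_fourier sum_distrib_left
    by (rule trans[OF sum.swap sum.cong[OF refl trans[OF sum.swap]]]) (simp add: left_diff_distrib)
  also have "\<dots> = (\<Sum>b\<in>{0..<n}. \<Sum>c\<in>{0..<n}. if c = b then of_int n * pair_coeff b b u else 0)"
    unfolding sum_unity'[OF n_pos]
  proof (intro sum.cong refl)
    fix b c assume bc: "b \<in> {0..<n}" "c \<in> {0..<n}"
    then have "n dvd c - b \<longleftrightarrow> c = b"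
      by (metis atLeastLessThan_iff mod_eq_dvd_iff mod_pos_pos_trivial)
    then show "pair_coeff b c u * (if n dvd c - b then of_int n else 0) =
        (if c = b then of_int n * pair_coeff b b u else 0)" by simp
  qed
  also have "\<dots> = of_int n * (\<Sum>b\<in>{0..<n}. pair_coeff b b u)"
    by (simp add: sum_distrib_left)
  finally show ?thesis using n_nz by simp
qed

definition discrepancy :: real where
  "discrepancy = (\<Sum>u\<in>residue_class t \<rho>. if n dvd u then 0 else window u (s u) ^ 2 - mean_square u)"

text \<open>
  Only the off-diagonal frequencies remain, with the phases of the actual starting points \<open>s(u)\<close>.
\<close>
lemma discrepancy_fourier:
  "of_int n ^ 2 * complex_of_real discrepancy =
     (\<Sum>b\<in>{0..<n}. \<Sum>c\<in>{0..<n}. if b = c then 0 else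
        gauss_sum b * cnj (gauss_sum c) * (\<Sum>u\<in>residue_class t \<rho>. dirichlet b (t - u) * cnj (dirichlet c (t - u)) * shift_phase (b - c) u))"
proof -
  have eq: "of_int n ^ 2 * complex_of_real (if n dvd u then 0 else window u (s u) ^ 2 - mean_square u)
      = (\<Sum>b\<in>{0..<n}. \<Sum>c\<in>{0..<n}. if b = c then 0 else pair_coeff b c u * shift_phase (b - c) u)" for u
  proof (cases "n dvd u")
    case True
    then show ?thesis by (simp add: shift_phase_def cong: if_cong)
  next
    case False
    have "(\<Sum>b\<in>{0..<n}. pair_coeff b b u) = (\<Sum>b\<in>{0..<n}. \<Sum>c\<in>{0..<n}. if b = c then pair_coeff b c u else 0)"
      by (simp)
    then have "of_int n ^ 2 * complex_of_real (window u (s u) ^ 2 - mean_square u) =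
       (\<Sum>b\<in>{0..<n}. \<Sum>c\<in>{0..<n}. pair_coeff b c u * unity n (- ((b - c) * s u)) - (if b = c then pair_coeff b c u else 0))"
      by (simp only: of_real_diff right_diff_distrib window_sq_fourier mean_square_fourier sum_subtractf)
    also have "\<dots> = (\<Sum>b\<in>{0..<n}. \<Sum>c\<in>{0..<n}. if b = c then 0 else pair_coeff b c u * shift_phase (b - c) u)"
      using False by (intro sum.cong refl) (simp add: shift_phase_def)
    finally show ?thesis using False by simp
  qed
  have "of_int n ^ 2 * complex_of_real discrepancy =
      (\<Sum>u\<in>residue_class t \<rho>. \<Sum>b\<in>{0..<n}. \<Sum>c\<in>{0..<n}. if b = c then 0 else pair_coeff b c u * shift_phase (b - c) u)"
    unfolding discrepancy_def of_real_sum sum_distrib_left eq ..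
  also have "\<dots> = (\<Sum>b\<in>{0..<n}. \<Sum>c\<in>{0..<n}. \<Sum>u\<in>residue_class t \<rho>. if b = c then 0 else pair_coeff b c u * shift_phase (b - c) u)"
    by (rule trans[OF sum.swap sum.cong[OF refl sum.swap]])
  also have "\<dots> = (\<Sum>b\<in>{0..<n}. \<Sum>c\<in>{0..<n}. if b = c then 0 else
        gauss_sum b * cnj (gauss_sum c) * (\<Sum>u\<in>residue_class t \<rho>. dirichlet b (t - u) * cnj (dirichlet c (t - u)) * shift_phase (b - c) u))"
    by (intro sum.cong refl) (simp add: pair_coeff_def sum_distrib_left mult_ac)
  finally show ?thesis .
qed

lemma card_class_le: "real (card (residue_class t \<rho>)) \<le> t"
proof -
  have "card (residue_class t \<rho>) \<le> card {1..<t}"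
    unfolding residue_class_def by (intro card_mono) auto
  then show ?thesis using t_pos by simp
qed

definition completion_bound :: real where
  "completion_bound = sqrt (n + 1) * (t + 2 * inv_sum) / n"

lemma completion_bound_nonneg: "completion_bound \<ge> 0"
  unfolding completion_bound_def using n_pos t_pos inv_sum_nonneg by simp

lemma incomplete_jacobi_le:
  assumes "\<not> n dvd d"
  shows "norm (\<Sum>u\<in>residue_class t \<rho>. unity n (a * u) * shift_phase d u) \<le> completion_bound"
  unfolding completion_bound_def
proof (rule incomplete_sum_le)
  fix v
  have "(\<Sum>k\<in>{0..<n}. unity n (a * k) * shift_phase d k * unity n (v * k)) =
      (\<Sum>u\<in>{0..<n}. shift_phase d u * unity n ((a + v) * u))"
    by (simp add: ring_distribs unity_add mult_ac)
  then show "norm (\<Sum>k\<in>{0..<n}. unity n (a * k) * shift_phase d k * unity n (v * k)) \<le> sqrt (n + 1)"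
    using norm_jacobi_le[OF assms] by simp
qed (use unity_mult_periodic shift_phase_periodic card_class_le residue_class_unity_le t_pos in auto)

lemma block_le: "norm (\<Sum>j\<in>{L..<L+4}. of_real (e j) * unity n (f j)) \<le> 4"
proof -
  have "norm (\<Sum>j\<in>{L..<L+4}. of_real (e j) * unity n (f j)) \<le> (\<Sum>j\<in>{L..<L+4}. 1)"
    by (rule sum_norm_le) (simp add: norm_mult e_le)
  then show ?thesis by simp
qed

text \<open>
  On one residue class of \<open>u\<close> modulo 4 the weights at the upper end of the window do not depend on \<open>u\<close>, so a
  geometric sum of length \<open>t - u\<close> depends on \<open>u\<close> through a single exponential. This makes the products in the
  discrepancy incomplete Jacobi sums.
\<close>
lemma dirichlet_closed_form:
  assumes b: "\<not> n dvd b"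
  obtains P Q where "norm P \<le> 4 * inverse_gap b" "norm Q \<le> 4 * inverse_gap b"
    "\<And>u. u \<in> residue_class t \<rho> \<Longrightarrow> dirichlet b (t - u) = P + Q * unity n (b * u)"
proof -
  let ?z = "1 - unity n (4 * (- b))"
  define A where "A = (\<Sum>j\<in>{0..<0+4}. of_real (e j) * unity n (- (b * j)))"
  define B where "B = unity n (- (b * t)) * (\<Sum>j\<in>{0..<0+4}. of_real (e (j + (t - \<rho>))) * unity n (- (b * j)))"
  have nb: "\<not> n dvd - b" using b by simp
  have kb: "inverse_gap (- b) = inverse_gap b"
    unfolding inverse_gap_def using complex_mod_cnj[of "1 - unity n (4 * b)"] by simp
  have "coprime n (4::int)"
    using odd_n coprime_power_right_iff[of n 2 2] by (simp add: coprime_right_2_iff_odd)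
  then have "\<not> n dvd 4 * (- b)" using nb by (metis coprime_dvd_mult_right_iff)
  then have z: "?z \<noteq> 0" using n_pos by (simp add: unity_eq_1_iff)
  have e_shift: "e (j + (t - \<rho>)) = e (j + (t - u))" if "u mod 4 = \<rho>" for u j
  proof -
    have eq: "j + (t - \<rho>) = j + (t - u) + u div 4 * 4"
      using div_mult_mod_eq[of u 4] that by linarith
    show ?thesis unfolding eq by (rule periodic_mult[of e 4, OF e_periodic])
  qed
  have cl: "dirichlet b (t - u) = A / ?z + (- B / ?z) * unity n (b * u)" if u: "u \<in> residue_class t \<rho>" for u
  proof -
    define L where "L = t - u"
    define \<phi> where "\<phi> = (\<lambda>j. complex_of_real (e j) * unity n (- (b * j)))"
    have L: "0 \<le> L" and ur: "u mod 4 = \<rho>" using u by (auto simp: residue_class_def L_def)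
    have "?z * \<phi> j = \<phi> j - \<phi> (j + 4)" for j
    proof -
      have "- (b * (j + 4)) = 4 * (- b) + - (b * j)" by (simp add: algebra_simps)
      then show ?thesis by (simp only: \<phi>_def unity_add e_periodic) (simp add: algebra_simps)
    qed
    then have "?z * dirichlet b L = (\<Sum>j\<in>{0..<L}. \<phi> j - \<phi> (j + 4))"
      by (simp only: dirichlet_def sum_distrib_left \<phi>_def)
    also have "\<dots> = A - (\<Sum>j\<in>{L..<L+4}. \<phi> j)"
      using telescope_4[OF L, of \<phi>] by (simp add: A_def \<phi>_def)
    also have "(\<Sum>j\<in>{L..<L+4}. \<phi> j) = (\<Sum>j\<in>{0..<0+4}. \<phi> (j + L))"
      by (rule sum.reindex_bij_witness[of _ "\<lambda>j. j + L" "\<lambda>j. j - L"]) auto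
    also have "\<dots> = B * unity n (b * u)"
      unfolding B_def \<phi>_def sum_distrib_left sum_distrib_right
    proof (intro sum.cong refl)
      fix j
      have "- (b * (j + L)) = - (b * t) + (- (b * j) + b * u)" by (simp add: L_def algebra_simps)
      then show "complex_of_real (e (j + L)) * unity n (- (b * (j + L))) =
         unity n (- (b * t)) * (complex_of_real (e (j + (t - \<rho>))) * unity n (- (b * j))) * unity n (b * u)"
        by (simp only: unity_add e_shift[OF ur] L_def mult_ac)
    qed
    finally have "dirichlet b L = (A - B * unity n (b * u)) / ?z"
      using z by (metis nonzero_mult_div_cancel_left)
    then show ?thesis by (simp add: L_def diff_divide_distrib)
  qed
  show ?thesis
  proof (rule that[OF _ _ cl])
    show "norm (A / ?z) \<le> 4 * inverse_gap b"
      using inverse_gap_mult[OF nb, of "A / ?z" 4] z block_le[where L=0 and f="\<lambda>j. - (b * j)"] kb by (simp add: A_def)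
    have "norm B \<le> (\<Sum>j\<in>{0..<0+4::int}. 1)"
      unfolding B_def norm_mult norm_unity mult_1_left by (rule sum_norm_le) (simp add: norm_mult e_le)
    then show "norm (- B / ?z) \<le> 4 * inverse_gap b"
      using inverse_gap_mult[OF nb, of "- B / ?z" 4] z kb by simp
  qed
qed

lemma norm_dirichlet_le: "L \<ge> 0 \<Longrightarrow> norm (dirichlet b L) \<le> L"
proof -
  have "norm (dirichlet b L) \<le> (\<Sum>j\<in>{0..<L}. 1)"
    unfolding dirichlet_def by (rule sum_norm_le) (simp add: norm_mult e_le)
  then show "L \<ge> 0 \<Longrightarrow> norm (dirichlet b L) \<le> L" by simp
qed

lemma norm_dirichlet_le_gap:
  assumes "\<not> n dvd b" "u \<in> residue_class t \<rho>"
  shows "norm (dirichlet b (t - u)) \<le> 8 * inverse_gap b"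
proof -
  obtain P Q where *: "norm P \<le> 4 * inverse_gap b" "norm Q \<le> 4 * inverse_gap b"
    "dirichlet b (t - u) = P + Q * unity n (b * u)"
    using dirichlet_closed_form[OF assms(1)] assms(2) by metis
  have "norm (dirichlet b (t - u)) \<le> norm P + norm (Q * unity n (b * u))"
    unfolding *(3) by (rule norm_triangle_ineq)
  then show ?thesis using * by (simp add: norm_mult)
qed

lemma class_sum_le:
  assumes b: "\<not> n dvd b" and c: "\<not> n dvd c" and d: "\<not> n dvd d"
  shows "norm (\<Sum>u\<in>residue_class t \<rho>. dirichlet b (t - u) * cnj (dirichlet c (t - u)) * shift_phase d u)
     \<le> 64 * completion_bound * (inverse_gap b * inverse_gap c)"
proof -
  obtain P Q where PQ: "norm P \<le> 4 * inverse_gap b" "norm Q \<le> 4 * inverse_gap b"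
    "\<And>u. u \<in> residue_class t \<rho> \<Longrightarrow> dirichlet b (t - u) = P + Q * unity n (b * u)"
    using dirichlet_closed_form[OF b] by metis
  obtain P' Q' where PQ': "norm P' \<le> 4 * inverse_gap c" "norm Q' \<le> 4 * inverse_gap c"
    "\<And>u. u \<in> residue_class t \<rho> \<Longrightarrow> dirichlet c (t - u) = P' + Q' * unity n (c * u)"
    using dirichlet_closed_form[OF c] by metis
  define T where "T = (\<lambda>a. \<Sum>u\<in>residue_class t \<rho>. unity n (a * u) * shift_phase d u)"
  have T: "norm (T a) \<le> completion_bound" for a unfolding T_def by (rule incomplete_jacobi_le[OF d])
  have "(\<Sum>u\<in>residue_class t \<rho>. dirichlet b (t - u) * cnj (dirichlet c (t - u)) * shift_phase d u) =
     (\<Sum>u\<in>residue_class t \<rho>. P * cnj P' * (unity n (0 * u) * shift_phase d u) + P * cnj Q' * (unity n (- c * u) * shift_phase d u)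
        + Q * cnj P' * (unity n (b * u) * shift_phase d u) + Q * cnj Q' * (unity n ((b - c) * u) * shift_phase d u))"
  proof (intro sum.cong refl)
    fix u assume u: "u \<in> residue_class t \<rho>"
    have "unity n ((b - c) * u) = unity n (b * u) * unity n (- c * u)"
      by (simp add: left_diff_distrib flip: unity_add)
    then show "dirichlet b (t - u) * cnj (dirichlet c (t - u)) * shift_phase d u =
      P * cnj P' * (unity n (0 * u) * shift_phase d u) + P * cnj Q' * (unity n (- c * u) * shift_phase d u)
        + Q * cnj P' * (unity n (b * u) * shift_phase d u) + Q * cnj Q' * (unity n ((b - c) * u) * shift_phase d u)"
      unfolding PQ(3)[OF u] PQ'(3)[OF u] by (simp add: algebra_simps)
  qed
  also have "\<dots> = P * cnj P' * T 0 + P * cnj Q' * T (- c) + Q * cnj P' * T b + Q * cnj Q' * T (b - c)"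
    unfolding T_def by (simp only: sum.distrib sum_distrib_left)
  also have "norm \<dots> \<le> norm (P * cnj P' * T 0) + norm (P * cnj Q' * T (- c)) + norm (Q * cnj P' * T b)
      + norm (Q * cnj Q' * T (b - c))"
    by (intro order.trans[OF norm_triangle_ineq] add_right_mono) auto
  also have "\<dots> \<le> (4 * inverse_gap b) * (4 * inverse_gap c) * completion_bound + (4 * inverse_gap b) * (4 * inverse_gap c) * completion_bound +
      (4 * inverse_gap b) * (4 * inverse_gap c) * completion_bound + (4 * inverse_gap b) * (4 * inverse_gap c) * completion_bound"
    unfolding norm_mult complex_mod_cnj
    by (intro add_mono mult_mono PQ PQ' T) (auto simp: inverse_gap_nonneg)
  finally show ?thesis by (simp add: mult_ac)
qed

text \<open>
  The bound for pairs in which one frequency is 0. There is no cancellation over \<open>u\<close> to use, but the trivial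
  estimate suffices, as \<open>G\<^sub>0 = -1\<close> is smaller than the other Gauss sums by a factor \<open>\<surd>(n+1)\<close>.
\<close>
lemma class_sum_le_single:
  assumes c: "\<not> n dvd c" and w: "\<And>u. norm (w u) \<le> 1"
  shows "norm (\<Sum>u\<in>residue_class t \<rho>. dirichlet b (t - u) * cnj (dirichlet c (t - u)) * w u)
     \<le> 8 * t ^ 2 * inverse_gap c"
proof -
  have "norm (\<Sum>u\<in>residue_class t \<rho>. dirichlet b (t - u) * cnj (dirichlet c (t - u)) * w u)
     \<le> (\<Sum>u\<in>residue_class t \<rho>. t * (8 * inverse_gap c) * 1)"
  proof (rule sum_norm_le)
    fix u assume u: "u \<in> residue_class t \<rho>"
    then have "norm (dirichlet b (t - u)) \<le> t"
      using norm_dirichlet_le[of "t - u" b] by (auto simp: residue_class_def)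
    then show "norm (dirichlet b (t - u) * cnj (dirichlet c (t - u)) * w u) \<le> t * (8 * inverse_gap c) * 1"
      unfolding norm_mult complex_mod_cnj using norm_dirichlet_le_gap[OF c u] w t_pos inverse_gap_nonneg
      by (intro mult_mono) auto
  qed
  also have "\<dots> = real (card (residue_class t \<rho>)) * (t * (8 * inverse_gap c))" by simp
  also have "\<dots> \<le> t * (t * (8 * inverse_gap c))"
    using card_class_le t_pos inverse_gap_nonneg by (intro mult_right_mono) auto
  finally show ?thesis by (simp add: power2_eq_square)
qed

text \<open>
  With \<open>t\<close> of order \<open>n\<close>, \<open>inv_sum\<close> of order \<open>n log n\<close> and the completion bound of order \<open>\<surd>n log n\<close>, the
  discrepancy is of order \<open>n\<^sup>3\<^sup>/\<^sup>2 log\<^sup>3 n\<close>. The first term comes from pairs of nonzero frequencies, the second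
  from pairs that contain 0.
\<close>
theorem discrepancy_le:
  "n ^ 2 * \<bar>discrepancy\<bar> \<le> 64 * (n + 1) * completion_bound * inv_sum ^ 2 + 16 * sqrt (n + 1) * t ^ 2 * inv_sum"
proof -
  define r where "r = sqrt (real_of_int (n + 1))"
  have r: "r \<ge> 0" "r * r = n + 1" using n_pos by (auto simp: r_def)
  let ?I = "\<lambda>b c. \<Sum>u\<in>residue_class t \<rho>. dirichlet b (t - u) * cnj (dirichlet c (t - u)) * shift_phase (b - c) u"
  have "n ^ 2 * \<bar>discrepancy\<bar> = norm (of_int n ^ 2 * complex_of_real discrepancy)"
    by (simp add: norm_mult norm_power)
  also have "\<dots> \<le> (\<Sum>b\<in>{0..<n}. \<Sum>c\<in>{0..<n}. r * r * (64 * completion_bound) * (inverse_gap b * inverse_gap c) +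
      (r * 8 * t ^ 2) * ((if b = 0 then inverse_gap c else 0) + (if c = 0 then inverse_gap b else 0)))"
    unfolding discrepancy_fourier
  proof (intro sum_norm_le)
    fix b c assume b: "b \<in> {0..<n}" and c: "c \<in> {0..<n}"
    have nn: "r * r * (64 * completion_bound) * (inverse_gap b * inverse_gap c) \<ge> 0" "(r * 8 * t ^ 2) * inverse_gap b \<ge> 0" "(r * 8 * t ^ 2) * inverse_gap c \<ge> 0"
      using r completion_bound_nonneg inverse_gap_nonneg n_pos by (auto intro!: mult_nonneg_nonneg)
    have nd: "\<not> n dvd b" if "b \<noteq> 0" "b \<in> {0..<n}" for b using that by (auto dest: zdvd_imp_le)
    have conj_I: "norm (?I b c) = norm (\<Sum>u\<in>residue_class t \<rho>. dirichlet c (t - u) * cnj (dirichlet b (t - u)) * cnj (shift_phase (b - c) u))"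
      by (subst complex_mod_cnj[symmetric]) (simp add: mult_ac)
    consider "b = c" | "b \<noteq> c" "b \<noteq> 0" "c \<noteq> 0" | "b \<noteq> c" "b = 0" "c \<noteq> 0" | "b \<noteq> c" "b \<noteq> 0" "c = 0" by blast
    then show "norm (if b = c then 0 else gauss_sum b * cnj (gauss_sum c) * ?I b c) \<le> r * r * (64 * completion_bound) * (inverse_gap b * inverse_gap c) +
      (r * 8 * t ^ 2) * ((if b = 0 then inverse_gap c else 0) + (if c = 0 then inverse_gap b else 0))"
    proof cases
      case 1
      then show ?thesis using nn by (simp add: inverse_gap_0)
    next
      case 2
      have "\<not> n dvd b - c"
        using 2 b c by (metis atLeastLessThan_iff mod_eq_dvd_iff mod_pos_pos_trivial)
      then have "norm (?I b c) \<le> 64 * completion_bound * (inverse_gap b * inverse_gap c)"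
        using nd[OF 2(2) b] nd[OF 2(3) c] by (intro class_sum_le)
      then have "norm (gauss_sum b * cnj (gauss_sum c) * ?I b c) \<le> r * r * (64 * completion_bound * (inverse_gap b * inverse_gap c))"
        unfolding norm_mult complex_mod_cnj r_def
        by (intro mult_mono norm_gauss_sum_le) (use n_pos in auto)
      then show ?thesis using 2 by (simp add: mult_ac)
    next
      case 3
      have "norm (?I b c) \<le> 8 * t ^ 2 * inverse_gap c" by (intro class_sum_le_single nd 3 c norm_shift_phase_le)
      then have "norm (gauss_sum b * cnj (gauss_sum c) * ?I b c) \<le> 1 * r * (8 * t ^ 2 * inverse_gap c)"
        unfolding norm_mult complex_mod_cnj using 3(2) r norm_gauss_sum_le[of c]
        by (intro mult_mono) (auto simp: gauss_sum_0 r_def)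
      then show ?thesis using 3 by (simp add: mult_ac inverse_gap_0)
    next
      case 4
      have "norm (?I b c) \<le> 8 * t ^ 2 * inverse_gap b"
        unfolding conj_I by (intro class_sum_le_single nd 4 b) (simp add: norm_shift_phase_le)
      then have "norm (gauss_sum b * cnj (gauss_sum c) * ?I b c) \<le> r * 1 * (8 * t ^ 2 * inverse_gap b)"
        unfolding norm_mult complex_mod_cnj using 4(3) r norm_gauss_sum_le[of b]
        by (intro mult_mono) (auto simp: gauss_sum_0 r_def)
      then show ?thesis using 4 by (simp add: mult_ac inverse_gap_0)
    qed
  qed
  also have "\<dots> = r * r * (64 * completion_bound) * ((\<Sum>b\<in>{0..<n}. inverse_gap b) * (\<Sum>c\<in>{0..<n}. inverse_gap c)) +
     (r * 8 * t ^ 2) * (\<Sum>b\<in>{0..<n}. \<Sum>c\<in>{0..<n}. (if b = 0 then inverse_gap c else 0) + (if c = 0 then inverse_gap b else 0))"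
    unfolding sum_product by (simp only: sum.distrib sum_distrib_left[symmetric])
  also have "(\<Sum>b\<in>{0..<n}. \<Sum>c\<in>{0..<n}. (if b = 0 then inverse_gap c else 0) + (if c = 0 then inverse_gap b else 0)) = inv_sum + inv_sum"
  proof -
    have 1: "(\<Sum>b\<in>{0..<n}. \<Sum>c\<in>{0..<n}. if c = 0 then inverse_gap b else 0) = inv_sum"
      using n_pos by (simp add: sum_inverse_gap)
    have 2: "(\<Sum>b\<in>{0..<n}. \<Sum>c\<in>{0..<n}. if b = 0 then inverse_gap c else 0) = inv_sum"
      by (subst sum.swap) (rule 1)
    show ?thesis by (simp only: sum.distrib 1 2)
  qed
  finally show ?thesis unfolding sum_inverse_gap r(2) by (simp add: r_def power2_eq_square mult_ac)
qed

end

section \<open>Sums of squares in arithmetic progressions\<close>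

text \<open>
  The series in \<open>1/h(T)\<close>, multiplied by \<open>T\<^sup>2\<close>; in this form it satisfies a recursion in \<open>T\<close>.
\<close>
definition square_sum :: "real \<Rightarrow> real" where
  "square_sum T = (\<Sum>k. (max 0 (T - real (Suc k))) ^ 2)"

lemma square_sum_finite:
  assumes "T \<le> real N"
  shows "square_sum T = (\<Sum>k<N. (max 0 (T - real (Suc k))) ^ 2)"
  unfolding square_sum_def using assms by (intro suminf_finite) (auto simp: max_def)

lemma square_sum_step:
  assumes "T \<ge> 0"
  shows "square_sum (T + 1) = T ^ 2 + square_sum T"
proof -
  obtain N where N: "T \<le> real N" using real_arch_simple by blast
  have "square_sum (T + 1) = (\<Sum>k<Suc N. (max 0 (T + 1 - real (Suc k))) ^ 2)"
    using N by (intro square_sum_finite) auto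
  also have "\<dots> = T ^ 2 + square_sum T"
    using assms by (subst sum.lessThan_Suc_shift) (simp add: square_sum_finite[OF N] algebra_simps)
  finally show ?thesis .
qed

lemma cube_le_square:
  fixes T :: real
  assumes "0 \<le> T" "T \<le> 1"
  shows "T ^ 3 / 3 - T ^ 2 / 2 \<le> 0"
  using power_decreasing[of 2 3 T] zero_le_power2[of T] assms by linarith

text \<open>
  All three expressions are controlled by their increments from \<open>T\<close> to \<open>T + 1\<close>: these are \<open>T\<^sup>2\<close> for the sum,
  \<open>T\<^sup>2 - 1/6\<close> for the lower and \<open>T\<^sup>2 + T + 1/3\<close> for the upper bound, and on \<open>[0, 1]\<close> the sum is 0.
\<close>
lemma square_sum_bounds:
  assumes "T \<ge> 0"
  shows "T ^ 3 / 3 - T ^ 2 / 2 \<le> square_sum T" "square_sum T \<le> T ^ 3 / 3"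
proof -
  have "T ^ 3 / 3 - T ^ 2 / 2 \<le> square_sum T \<and> square_sum T \<le> T ^ 3 / 3"
    if "0 \<le> T" "T \<le> real (Suc N)" for N T
    using that
  proof (induction N arbitrary: T)
    case 0
    have "T ^ 3 / 3 - T ^ 2 / 2 \<le> 0" using 0 by (intro cube_le_square) auto
    moreover have "square_sum T = 0" using 0 square_sum_finite[of T 1] by simp
    ultimately show ?case using 0 by simp
  next
    case (Suc N)
    show ?case
    proof (cases "T \<le> 1")
      case True
      have "T ^ 3 / 3 - T ^ 2 / 2 \<le> 0" using Suc True by (intro cube_le_square) auto
      moreover have "square_sum T = 0" using True square_sum_finite[of T 1] by simp
      ultimately show ?thesis using Suc by simp
    next
      case False
      define S where "S = T - 1"
      have S: "0 \<le> S" "S \<le> real (Suc N)" and T: "T = S + 1" using False Suc.prems by (auto simp: S_def)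
      show ?thesis
        using Suc.IH[OF S] S(1) unfolding T square_sum_step[OF S(1)]
        by (auto simp: power3_eq_cube power2_eq_square field_simps)
    qed
  qed
  moreover obtain N where "T \<le> real (Suc N)"
    by (metis linear not_less_eq_eq of_nat_le_iff order.trans real_arch_simple)
  ultimately show "T ^ 3 / 3 - T ^ 2 / 2 \<le> square_sum T" "square_sum T \<le> T ^ 3 / 3"
    using assms by blast+
qed

lemma square_sum_tendsto:
  assumes "(f \<longlongrightarrow> T) F"
  shows "((\<lambda>d. square_sum (f d)) \<longlongrightarrow> square_sum T) F"
proof -
  obtain N where N: "T < real N" using reals_Archimedean2 by blast
  have "((\<lambda>d. \<Sum>k<N. (max 0 (f d - real (Suc k))) ^ 2) \<longlongrightarrow> (\<Sum>k<N. (max 0 (T - real (Suc k))) ^ 2)) F"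
    using assms by (intro tendsto_intros)
  moreover have "\<forall>\<^sub>F d in F. (\<Sum>k<N. (max 0 (f d - real (Suc k))) ^ 2) = square_sum (f d)"
    using order_tendstoD(2)[OF assms N] by eventually_elim (rule square_sum_finite[symmetric], simp)
  ultimately show ?thesis
    using N square_sum_finite[of T N] by (simp add: tendsto_cong)
qed

lemma max_diff_scale:
  "T > 0 \<Longrightarrow> max 0 (1 - a / T) = max 0 (T - a) / (T::real)"
  by (auto simp: max_def field_simps)

text \<open>
  The limit \<open>1/h(T)\<close> of the reciprocals must not be 0. For \<open>T < 3/2\<close> the first two terms are already positive, for
  \<open>T > 3/2\<close> the lower bound for \<open>square_sum\<close> gives at least \<open>2T/3 - 1\<close>, and at \<open>T = 3/2\<close> the first term
  of the sum is positive.
\<close>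
lemma limit_value_pos:
  assumes "T > 0"
  shows "1 - 2 * T / 3 + 4 * (square_sum T / T ^ 2) > 0"
proof -
  have nn: "square_sum T \<ge> 0"
    using square_sum_finite real_arch_simple[of T] by (metis sum_nonneg zero_le_power2)
  consider "T < 3 / 2" | "T = 3 / 2" | "T > 3 / 2" by linarith
  then show ?thesis
  proof cases
    case 1
    then show ?thesis using nn assms by (simp add: add_pos_nonneg)
  next
    case 2
    have "square_sum (1/2 + 1) = (1/2) ^ 2 + square_sum (1/2)" by (rule square_sum_step) simp
    moreover have "square_sum (1/2) \<ge> 0"
      using square_sum_finite[of "1/2" 1] by simp
    ultimately show ?thesis unfolding 2 by (simp add: power2_eq_square)
  next
    case 3
    have "(T ^ 3 / 3 - T ^ 2 / 2) / T ^ 2 \<le> square_sum T / T ^ 2"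
      using assms square_sum_bounds(1)[of T] by (intro divide_right_mono) auto
    moreover have "(T ^ 3 / 3 - T ^ 2 / 2) / T ^ 2 = T / 3 - 1 / 2"
      using assms by (simp add: field_simps power3_eq_cube power2_eq_square)
    ultimately show ?thesis using 3 by simp
  qed
qed

definition multiple_squares :: "int \<Rightarrow> int \<Rightarrow> real" where
  "multiple_squares p t = (\<Sum>v\<in>{1..<t}. if p dvd v then (of_int (t - v)) ^ 2 else 0)"

text \<open>
  Both sums that occur in the sum of squared correlations, over multiples of \<open>qn\<close> and of \<open>q\<close>, are values of the same function.
\<close>
lemma multiple_squares_eq:
  assumes p: "p > 0" and t: "t \<ge> 0"
  shows "multiple_squares p t = of_int p ^ 2 * square_sum (t / p)"
proof -
  have "multiple_squares p t = (\<Sum>v\<in>{v \<in> {1..<t}. p dvd v}. (of_int (t - v)) ^ 2)"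
    unfolding multiple_squares_def by (rule sum.inter_filter[symmetric]) simp
  also have "\<dots> = (\<Sum>k\<in>{k. k < nat t \<and> (int k + 1) * p < t}. (of_int (t - (int k + 1) * p)) ^ 2)"
  proof (rule sum.reindex_bij_witness[of _ "\<lambda>k. (int k + 1) * p" "\<lambda>v. nat (v div p - 1)"])
    fix v assume "v \<in> {v \<in> {1..<t}. p dvd v}"
    then obtain m where m: "v = p * m" "1 \<le> v" "v < t" by auto
    then have "m \<ge> 1" using p by (smt (verit) mult_nonneg_nonpos)
    moreover have "m \<le> v" using m p \<open>m \<ge> 1\<close> by (simp add: mult_le_cancel_right1)
    then have "m < t" using m by linarith
    ultimately show "(int (nat (v div p - 1)) + 1) * p = v"
      "nat (v div p - 1) \<in> {k. k < nat t \<and> (int k + 1) * p < t}"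
      "(real_of_int (t - (int (nat (v div p - 1)) + 1) * p))\<^sup>2 = (real_of_int (t - v))\<^sup>2"
      using m p by (auto simp: mult.commute)
  next
    fix k assume "k \<in> {k. k < nat t \<and> (int k + 1) * p < t}"
    then have k: "k < nat t" "(int k + 1) * p < t" by auto
    show "nat ((int k + 1) * p div p - 1) = k" using p by simp
    have "1 * 1 \<le> (int k + 1) * p" using p by (intro mult_mono) auto
    then show "(int k + 1) * p \<in> {v \<in> {1..<t}. p dvd v}" using k by simp
  qed
  also have "\<dots> = (\<Sum>k\<in>{..<nat t}. of_int p ^ 2 * (max 0 (t / p - real (Suc k))) ^ 2)"
  proof (rule sum.mono_neutral_cong_left)
    show "\<forall>k\<in>{..<nat t} - {k. k < nat t \<and> (int k + 1) * p < t}.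
        of_int p ^ 2 * (max 0 (t / p - real (Suc k))) ^ 2 = 0"
    proof
      fix k assume "k \<in> {..<nat t} - {k. k < nat t \<and> (int k + 1) * p < t}"
      then have "t \<le> (int k + 1) * p" by auto
      then have "real_of_int t \<le> real_of_int ((int k + 1) * p)" by (simp only: of_int_le_iff)
      then have "t / p \<le> real (Suc k)" using p by (simp add: field_simps)
      then show "of_int p ^ 2 * (max 0 (t / p - real (Suc k))) ^ 2 = 0" by simp
    qed
    fix k assume "k \<in> {k. k < nat t \<and> (int k + 1) * p < t}"
    then have "real_of_int ((int k + 1) * p) < real_of_int t" by (simp only: of_int_less_iff mem_Collect_eq)
    then have "real (Suc k) \<le> t / p" using p by (simp add: field_simps)
    then have "max 0 (t / p - real (Suc k)) = t / p - real (Suc k)" by simp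
    then show "(of_int (t - (int k + 1) * p)) ^ 2 = of_int p ^ 2 * (max 0 (t / p - real (Suc k))) ^ 2"
      using p by (simp add: power_mult_distrib[symmetric] algebra_simps)
  qed auto
  also have "\<dots> = of_int p ^ 2 * square_sum (t / p)"
  proof -
    have "t / p \<le> real (nat t)"
      using p t mult_left_mono[of 1 "real_of_int p" "real_of_int t"] by (simp add: divide_le_eq)
    then show ?thesis by (simp add: square_sum_finite sum_distrib_left)
  qed
  finally show ?thesis .
qed

lemma multiple_squares_bounds:
  assumes p: "p > 0" and t: "t \<ge> 0"
  shows "real_of_int t ^ 3 / (3 * real_of_int p) - real_of_int t ^ 2 / 2 \<le> multiple_squares p t"
    "multiple_squares p t \<le> real_of_int t ^ 3 / (3 * real_of_int p)"
proof -
  let ?T = "of_int t / of_int p :: real"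
  have T: "?T \<ge> 0" using assms by simp
  have eq: "of_int p ^ 2 * (?T ^ 3 / 3 - ?T ^ 2 / 2) = real_of_int t ^ 3 / (3 * real_of_int p) - real_of_int t ^ 2 / 2"
    "of_int p ^ 2 * (?T ^ 3 / 3) = real_of_int t ^ 3 / (3 * real_of_int p)"
    using p by (simp_all add: field_simps power3_eq_cube power2_eq_square)
  have "of_int p ^ 2 * (?T ^ 3 / 3 - ?T ^ 2 / 2) \<le> multiple_squares p t"
    unfolding multiple_squares_eq[OF assms] using square_sum_bounds(1)[OF T] by (intro mult_left_mono) auto
  then show "real_of_int t ^ 3 / (3 * real_of_int p) - real_of_int t ^ 2 / 2 \<le> multiple_squares p t"
    unfolding eq .
  have "multiple_squares p t \<le> of_int p ^ 2 * (?T ^ 3 / 3)"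
    unfolding multiple_squares_eq[OF assms] using square_sum_bounds(2)[OF T] by (intro mult_left_mono) auto
  then show "multiple_squares p t \<le> real_of_int t ^ 3 / (3 * real_of_int p)"
    unfolding eq .
qed

section \<open>The sum of squared correlations of a signed sequence\<close>

text \<open>
  Grouping the pairs \<open>(j, k)\<close> by their difference. It splits the coincidences of a window by the difference
  of the indices and, read backwards through \<open>sum_power2_eq\<close>, sums them over all shifts.
\<close>
lemma sum_square_symmetric:
  fixes F :: "int \<Rightarrow> int \<Rightarrow> real"
  assumes sym: "\<And>j k. F j k = F k j" and L: "L \<ge> 0"
  shows "(\<Sum>j\<in>{0..<L}. \<Sum>k\<in>{0..<L}. F j k) =
    (\<Sum>j\<in>{0..<L}. F j j) + 2 * (\<Sum>u\<in>{1..<L}. \<Sum>j\<in>{0..<L-u}. F j (j + u))"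
  using L
proof (induction L rule: int_ge_induct)
  case (step L)
  have e: "{0..<L+1} = insert L {0..<L}" using step by auto
  have "(\<Sum>u\<in>{1..<L+1}. \<Sum>j\<in>{0..<L+1-u}. F j (j + u)) =
      (\<Sum>u\<in>{1..<L+1}. F (L - u) L + (\<Sum>j\<in>{0..<L-u}. F j (j + u)))"
  proof (intro sum.cong refl)
    fix u assume "u \<in> {1..<L+1}"
    then have "{0..<L+1-u} = insert (L-u) {0..<L-u}" by auto
    then show "(\<Sum>j\<in>{0..<L+1-u}. F j (j + u)) = F (L - u) L + (\<Sum>j\<in>{0..<L-u}. F j (j + u))" by simp
  qed
  also have "\<dots> = (\<Sum>u\<in>{1..<L+1}. F (L - u) L) + (\<Sum>u\<in>{1..<L+1}. \<Sum>j\<in>{0..<L-u}. F j (j + u))"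
    by (rule sum.distrib)
  also have "(\<Sum>u\<in>{1..<L+1}. F (L - u) L) = (\<Sum>j\<in>{0..<L}. F j L)"
    by (rule sum.reindex_bij_witness[of _ "\<lambda>j. L - j" "\<lambda>u. L - u"]) auto
  also have "(\<Sum>u\<in>{1..<L+1}. \<Sum>j\<in>{0..<L-u}. F j (j + u)) = (\<Sum>u\<in>{1..<L}. \<Sum>j\<in>{0..<L-u}. F j (j + u))"
    by (rule sum.mono_neutral_right) auto
  finally have "(\<Sum>u\<in>{1..<L+1}. \<Sum>j\<in>{0..<L+1-u}. F j (j + u)) =
     (\<Sum>j\<in>{0..<L}. F j L) + (\<Sum>u\<in>{1..<L}. \<Sum>j\<in>{0..<L-u}. F j (j + u))" .
  moreover have "(\<Sum>j\<in>{0..<L+1}. \<Sum>k\<in>{0..<L+1}. F j k) =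
     F L L + 2 * (\<Sum>j\<in>{0..<L}. F j L) + (\<Sum>j\<in>{0..<L}. \<Sum>k\<in>{0..<L}. F j k)"
  proof -
    have "(\<Sum>k\<in>{0..<L}. F L k) = (\<Sum>j\<in>{0..<L}. F j L)" by (rule sum.cong[OF refl sym])
    then show ?thesis unfolding e by (simp add: sum.distrib)
  qed
  moreover have "(\<Sum>j\<in>{0..<L+1}. F j j) = F L L + (\<Sum>j\<in>{0..<L}. F j j)"
    unfolding e by simp
  ultimately show ?case using step.IH by linarith
qed simp

lemma sum_power2_eq:
  fixes a :: "int \<Rightarrow> real"
  assumes "L \<ge> 0"
  shows "(\<Sum>j\<in>{0..<L}. a j) ^ 2 =
    (\<Sum>j\<in>{0..<L}. a j ^ 2) + 2 * (\<Sum>u\<in>{1..<L}. \<Sum>j\<in>{0..<L-u}. a j * a (j + u))"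
  using sum_square_symmetric[of "\<lambda>j k. a j * a k" L] assms
  by (simp add: power2_eq_square sum_product mult.commute)

lemma balanced_partial_sum_le:
  fixes e :: "int \<Rightarrow> real"
  assumes per: "\<And>k. e (k + 4) = e k" and le: "\<And>k. \<bar>e k\<bar> \<le> 1" and zero: "(\<Sum>k\<in>{0..<4}. e k) = 0"
  shows "\<bar>\<Sum>j\<in>{0..<L}. e j\<bar> \<le> 4"
proof (induction "nat L" arbitrary: L rule: less_induct)
  case less
  show ?case
  proof (cases "L < 4")
    case True
    have "\<bar>\<Sum>j\<in>{0..<L}. e j\<bar> \<le> (\<Sum>j\<in>{0..<L}. 1)"
      by (rule order.trans[OF sum_abs sum_mono]) (rule le)
    also have "\<dots> \<le> 4" using True by simp
    finally show ?thesis .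
  next
    case False
    have "{0..<L} = {0..<4} \<union> {4..<L}" using False by auto
    then have "(\<Sum>j\<in>{0..<L}. e j) = (\<Sum>j\<in>{0..<4}. e j) + (\<Sum>j\<in>{4..<L}. e j)"
      by (simp only:) (rule sum.union_disjoint; auto)
    also have "(\<Sum>j\<in>{4..<L}. e j) = (\<Sum>j\<in>{0..<L-4}. e (j + 4))"
      by (rule sum.reindex_bij_witness[of _ "\<lambda>j. j + 4" "\<lambda>j. j - 4"]) auto
    finally have "(\<Sum>j\<in>{0..<L}. e j) = (\<Sum>j\<in>{0..<L-4}. e j)" by (simp add: zero per)
    then show ?thesis using less[of "L - 4"] False by simp
  qed
qed

lemma card_multiples_le:
  fixes n t :: int
  assumes "n > 0" "t \<ge> 1"
  shows "real (card {v \<in> {1..<t}. n dvd v}) \<le> t / n"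
proof -
  have "card {v \<in> {1..<t}. n dvd v} \<le> card {1..t div n}"
  proof (rule card_inj_on_le[of "\<lambda>v. v div n"])
    show "inj_on (\<lambda>v. v div n) {v \<in> {1..<t}. n dvd v}"
      using assms by (intro inj_onI) (auto simp: dvd_def)
    show "(\<lambda>v. v div n) ` {v \<in> {1..<t}. n dvd v} \<subseteq> {1..t div n}"
      using assms by (auto simp: zdiv_mono1 pos_imp_zdiv_pos_iff dest: zdvd_imp_le)
         (smt (verit) pos_imp_zdiv_pos_iff zdvd_imp_le)
  qed auto
  then have "real (card {v \<in> {1..<t}. n dvd v}) \<le> real_of_int (t div n)"
    using assms pos_imp_zdiv_nonneg_iff[of n t] by (simp add: le_nat_iff of_nat_le_iff[symmetric, where 'a=int] del: of_nat_le_iff)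
  also have "\<dots> \<le> t / n" by (rule real_of_int_div4)  
  finally show ?thesis .
qed

text \<open>
  For the three patterns \<open>q\<close> is 1, 2 and 4: the product \<open>\<epsilon>\<^sub>j \<epsilon>\<^sub>j\<^sub>+\<^sub>u\<close> is constant or balanced according to whether \<open>q\<close>
  divides \<open>u\<close>.
\<close>
locale sign_pattern = shift_and_add +
  fixes \<epsilon> :: "int \<Rightarrow> real" and q :: int and t :: int
  assumes \<epsilon>_periodic: "\<epsilon> (k + 4) = \<epsilon> k" and \<epsilon>_square: "\<epsilon> k * \<epsilon> k = 1"
    and q_pos: "q > 0" and q_dvd: "q dvd 4"
    and \<epsilon>_constant: "q dvd u \<Longrightarrow> \<epsilon> j * \<epsilon> (j + u) = \<epsilon> k * \<epsilon> (k + u)"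
    and \<epsilon>_balanced: "\<not> q dvd u \<Longrightarrow> (\<Sum>k\<in>{0..<4}. \<epsilon> k * \<epsilon> (k + u)) = 0"
    and t_ge: "t \<ge> 1"
begin

definition e :: "int \<Rightarrow> int \<Rightarrow> real" where
  "e u j = \<epsilon> j * \<epsilon> (j + u)"

lemma e_sq: "e u j * e u j = 1"
proof -
  have "e u j * e u j = (\<epsilon> j * \<epsilon> j) * (\<epsilon> (j + u) * \<epsilon> (j + u))" by (simp add: e_def mult_ac)
  then show ?thesis by (simp add: \<epsilon>_square)
qed

lemma abs_e: "\<bar>e u j\<bar> = 1"
  using e_sq[of u j] abs_square_eq_1[of "e u j"] by (simp add: power2_eq_square)

lemma e_periodic: "e u (j + 4) = e u j"
  unfolding e_def using \<epsilon>_periodic[of j] \<epsilon>_periodic[of "j + u"] by (simp add: add_ac)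

lemma e_mod: "e (u mod 4) = e u"
proof
  fix j
  have "\<epsilon> (j + u mod 4 + u div 4 * 4) = \<epsilon> (j + u mod 4)"
    by (rule periodic_mult[of \<epsilon> 4, OF \<epsilon>_periodic])
  then show "e (u mod 4) j = e u j" by (simp add: e_def add.assoc)
qed

definition sign_corr :: "int \<Rightarrow> real" where
  "sign_corr u = (\<Sum>j\<in>{0..<t-u}. e u j)"

lemma sign_corr_dvd: "q dvd u \<Longrightarrow> u \<le> t \<Longrightarrow> sign_corr u ^ 2 = (of_int (t - u)) ^ 2"
proof -
  assume u: "q dvd u" "u \<le> t"
  have "sign_corr u = (\<Sum>j\<in>{0..<t-u}. e u 0)"
    unfolding sign_corr_def e_def by (intro sum.cong refl \<epsilon>_constant[OF u(1)])
  then have "sign_corr u = of_int (t - u) * e u 0" using u by simp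
  then show "sign_corr u ^ 2 = (of_int (t - u)) ^ 2"
    using e_sq[of u 0] by (simp add: power_mult_distrib power2_eq_square)
qed

lemma sign_corr_not_dvd: "\<not> q dvd u \<Longrightarrow> sign_corr u ^ 2 \<le> 16"
proof -
  assume u: "\<not> q dvd u"
  have "\<bar>sign_corr u\<bar> \<le> 4"
    unfolding sign_corr_def
    by (rule balanced_partial_sum_le) (use e_periodic abs_e \<epsilon>_balanced[OF u] in \<open>auto simp: e_def\<close>)
  then have "\<bar>sign_corr u\<bar> ^ 2 \<le> 4 ^ 2" by (intro power_mono) auto
  then show "sign_corr u ^ 2 \<le> 16" by simp
qed

lemma abs_sign_corr_le: "u \<le> t \<Longrightarrow> \<bar>sign_corr u\<bar> \<le> t - u"
proof -
  assume u: "u \<le> t"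
  have "\<bar>sign_corr u\<bar> \<le> (\<Sum>j\<in>{0..<t-u}. \<bar>e u j\<bar>)" unfolding sign_corr_def by (rule sum_abs)
  then show ?thesis using u by (simp add: abs_e)
qed

definition corr :: "int \<Rightarrow> real" where
  "corr u = (\<Sum>j\<in>{0..<t-u}. (\<epsilon> j * x j) * (\<epsilon> (j + u) * x (j + u)))"

lemma corr_dvd: "n dvd u \<Longrightarrow> corr u = sign_corr u"
  unfolding corr_def sign_corr_def e_def
  by (intro sum.cong refl) (metis (no_types, lifting) mult.left_commute mult.right_neutral mult.assoc x_mult_dvd)

lemma corr_not_dvd: "\<not> n dvd u \<Longrightarrow> corr u = (\<Sum>j\<in>{0..<t-u}. e u j * x (j + s u))"
  unfolding corr_def e_def
  by (intro sum.cong refl) (simp add: x_mult[symmetric] mult_ac)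

definition mean :: "int \<Rightarrow> real" where
  "mean u = (\<Sum>m\<in>{0..<n}. (\<Sum>j\<in>{0..<t-u}. e u j * x (j + m)) ^ 2) / n"

text \<open>
  The part of the mean square that is large: a pair of indices congruent modulo \<open>n\<close> contributes the same
  value for every starting point.
\<close>
definition coincidences :: "int \<Rightarrow> real" where
  "coincidences u = (\<Sum>j\<in>{0..<t-u}. \<Sum>k\<in>{0..<t-u}. if n dvd k - j then e u j * e u k else 0)"

text \<open>
  The mean of \<open>x\<^sub>j\<^sub>+\<^sub>m x\<^sub>k\<^sub>+\<^sub>m\<close> over \<open>m\<close> is \<open>1\<close> if \<open>j\<close> and \<open>k\<close> are congruent modulo \<open>n\<close>, and \<open>-1/n\<close> otherwise.
\<close>
lemma mean_eq: "n * mean u = (n + 1) * coincidences u - sign_corr u ^ 2"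
proof -
  have corr': "(\<Sum>m\<in>{0..<n}. x (j + m) * x (k + m)) = (if n dvd k - j then of_int n + 1 else 0) - 1" for j k
  proof -
    have "(\<Sum>m\<in>{0..<n}. x (m + j) * x (m + j + (k - j))) = (\<Sum>m\<in>{0..<n}. x m * x (m + (k - j)))"
      by (rule sum_periodic_shift[of n "\<lambda>m. x m * x (m + (k - j))", OF n_pos])
         (metis x_periodic add.assoc add.commute)
    then show ?thesis by (simp add: x_correlation add.commute)
  qed
  have "n * mean u = (\<Sum>m\<in>{0..<n}. \<Sum>j\<in>{0..<t-u}. \<Sum>k\<in>{0..<t-u}. e u j * e u k * (x (j + m) * x (k + m)))"
    unfolding mean_def power2_eq_square sum_product using n_nz by (simp add: mult_ac)
  also have "\<dots> = (\<Sum>j\<in>{0..<t-u}. \<Sum>k\<in>{0..<t-u}. e u j * e u k * (\<Sum>m\<in>{0..<n}. x (j + m) * x (k + m)))"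
    unfolding sum_distrib_left by (rule trans[OF sum.swap sum.cong[OF refl sum.swap]])
  also have "\<dots> = (\<Sum>j\<in>{0..<t-u}. \<Sum>k\<in>{0..<t-u}. (n + 1) * (if n dvd k - j then e u j * e u k else 0) - e u j * e u k)"
    unfolding corr' by (intro sum.cong refl) (simp add: algebra_simps)
  also have "\<dots> = (n + 1) * coincidences u - sign_corr u ^ 2"
    unfolding coincidences_def sign_corr_def power2_eq_square sum_product
    by (simp only: sum_subtractf sum_distrib_left)
  finally show ?thesis .
qed

lemma mean_nonneg: "mean u \<ge> 0"
  unfolding mean_def using n_pos by (intro divide_nonneg_nonneg sum_nonneg) auto

lemma coincidences_eq:
  assumes u: "u \<in> {1..<t}"
  shows "coincidences u = of_int (t - u) +
    2 * (\<Sum>v\<in>{1..<t}. if n dvd v then (\<Sum>j\<in>{0..<t-v-u}. e v j * e v (j + u)) else 0)"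
proof -
  have "coincidences u = (\<Sum>j\<in>{0..<t-u}. 1) +
      2 * (\<Sum>v\<in>{1..<t-u}. \<Sum>j\<in>{0..<t-u-v}. if n dvd v then e u j * e u (j + v) else 0)"
    unfolding coincidences_def using u
    by (subst sum_square_symmetric) (auto simp: e_sq dvd_diff_commute mult.commute)
  also have "(\<Sum>v\<in>{1..<t-u}. \<Sum>j\<in>{0..<t-u-v}. if n dvd v then e u j * e u (j + v) else 0)
     = (\<Sum>v\<in>{1..<t}. \<Sum>j\<in>{0..<t-u-v}. if n dvd v then e u j * e u (j + v) else 0)"
    using u by (intro sum.mono_neutral_left) auto
  also have "\<dots> = (\<Sum>v\<in>{1..<t}. if n dvd v then (\<Sum>j\<in>{0..<t-v-u}. e v j * e v (j + u)) else 0)"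
    by (intro sum.cong refl) (simp add: e_def algebra_simps)
  finally show ?thesis using u by simp
qed

text \<open>
  The product of four signs in a coincidence, \<open>\<epsilon>\<^sub>j \<epsilon>\<^sub>j\<^sub>+\<^sub>u \<epsilon>\<^sub>j\<^sub>+\<^sub>v \<epsilon>\<^sub>j\<^sub>+\<^sub>u\<^sub>+\<^sub>v\<close>, is symmetric in \<open>u\<close> and \<open>v\<close>. For a fixed
  multiple \<open>v\<close> of \<open>n\<close>, the sum over \<open>j\<close> and \<open>u\<close> is therefore the sum over all pairs of indices \<open>j, k\<close> below \<open>t - v\<close> of
  \<open>e v j * e v k\<close> with \<open>j < k\<close>, which is half of \<open>E\<^sub>v\<^sup>2 - (t - v)\<close>, where \<open>E\<^sub>v\<close> is \<open>sign_corr v\<close>.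
\<close>
lemma sum_coincidences:
  "(\<Sum>u\<in>{1..<t}. coincidences u) = of_int t * (of_int t - 1) / 2 +
     (\<Sum>v\<in>{1..<t}. if n dvd v then sign_corr v ^ 2 - of_int (t - v) else 0)"
proof -
  have tri: "(\<Sum>u\<in>{1..<t}. real_of_int (t - u)) = of_int t * (of_int t - 1) / 2"
  proof -
    have "(\<Sum>j\<in>{0..<t}. 1::real) ^ 2 = (\<Sum>j\<in>{0..<t}. 1 ^ 2) + 2 * (\<Sum>u\<in>{1..<t}. \<Sum>j\<in>{0..<t-u}. 1 * 1)"
      using t_ge by (intro sum_power2_eq) auto
    moreover have "(\<Sum>u\<in>{1..<t}. \<Sum>j\<in>{0..<t-u}. 1 * 1 :: real) = (\<Sum>u\<in>{1..<t}. real_of_int (t - u))"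
      by (intro sum.cong) auto
    ultimately show ?thesis using t_ge by (simp add: power2_eq_square algebra_simps)
  qed
  have inner: "2 * (\<Sum>u\<in>{1..<t}. \<Sum>j\<in>{0..<t-v-u}. e v j * e v (j + u)) = sign_corr v ^ 2 - of_int (t - v)"
    if v: "v \<in> {1..<t}" for v
  proof -
    have "(\<Sum>u\<in>{1..<t-v}. \<Sum>j\<in>{0..<t-v-u}. e v j * e v (j + u)) = (\<Sum>u\<in>{1..<t}. \<Sum>j\<in>{0..<t-v-u}. e v j * e v (j + u))"
      using v by (intro sum.mono_neutral_left) auto
    moreover have "sign_corr v ^ 2 = (\<Sum>j\<in>{0..<t-v}. e v j ^ 2) + 2 * (\<Sum>u\<in>{1..<t-v}. \<Sum>j\<in>{0..<t-v-u}. e v j * e v (j + u))"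
      unfolding sign_corr_def using v by (intro sum_power2_eq) auto
    moreover have "(\<Sum>j\<in>{0..<t-v}. e v j ^ 2) = of_int (t - v)"
      using v by (simp add: power2_eq_square e_sq)
    ultimately show ?thesis by simp
  qed
  have "(\<Sum>u\<in>{1..<t}. coincidences u) = (\<Sum>u\<in>{1..<t}. real_of_int (t - u) +
     (\<Sum>v\<in>{1..<t}. if n dvd v then 2 * (\<Sum>j\<in>{0..<t-v-u}. e v j * e v (j + u)) else 0))"
    by (intro sum.cong refl) (simp add: coincidences_eq sum_distrib_left if_distrib cong: if_cong)
  also have "\<dots> = of_int t * (of_int t - 1) / 2 + (\<Sum>v\<in>{1..<t}. \<Sum>u\<in>{1..<t}.
      if n dvd v then 2 * (\<Sum>j\<in>{0..<t-v-u}. e v j * e v (j + u)) else 0)"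
    unfolding sum.distrib tri by (subst sum.swap) (rule refl)
  also have "(\<Sum>v\<in>{1..<t}. \<Sum>u\<in>{1..<t}. if n dvd v then 2 * (\<Sum>j\<in>{0..<t-v-u}. e v j * e v (j + u)) else 0)
     = (\<Sum>v\<in>{1..<t}. if n dvd v then sign_corr v ^ 2 - of_int (t - v) else 0)"
    by (intro sum.cong refl) (simp add: inner sum_distrib_left[symmetric])
  finally show ?thesis .
qed

text \<open>
  The bound of \<open>windowed.discrepancy_le\<close>, solved for the discrepancy.
\<close>
definition disc_bound :: real where
  "disc_bound = (64 * (n + 1) * (sqrt (n + 1) * (t + 2 * inv_sum) / n) * inv_sum ^ 2
     + 16 * sqrt (n + 1) * t ^ 2 * inv_sum) / n ^ 2"

text \<open>
  On a residue class modulo 4 the sign products are the same function for all \<open>u\<close>, as \<open>windowed\<close> requires.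
\<close>
lemma class_discrepancy_le:
  "\<bar>\<Sum>u\<in>residue_class t \<rho>. if n dvd u then 0 else corr u ^ 2 - mean u\<bar> \<le> disc_bound"
proof -
  interpret W: windowed n x s "e \<rho>" t \<rho>
    by unfold_locales (auto simp: e_periodic abs_e t_ge)
  have "W.discrepancy = (\<Sum>u\<in>residue_class t \<rho>. if n dvd u then 0 else corr u ^ 2 - mean u)"
    unfolding W.discrepancy_def
  proof (intro sum.cong refl)
    fix u assume "u \<in> residue_class t \<rho>"
    then have "e \<rho> = e u" using e_mod[of u] by (auto simp: residue_class_def)
    then show "(if n dvd u then 0 else W.window u (s u) ^ 2 - W.mean_square u)
       = (if n dvd u then 0 else corr u ^ 2 - mean u)"
      unfolding W.window_def W.mean_square_def mean_def by (simp add: corr_not_dvd)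
  qed
  then show ?thesis
    using W.discrepancy_le n_pos by (simp add: disc_bound_def W.completion_bound_def field_simps)
qed

lemma discrepancy_sum_le:
  "\<bar>\<Sum>u\<in>{1..<t}. if n dvd u then 0 else corr u ^ 2 - mean u\<bar> \<le> 4 * disc_bound"
proof -
  let ?f = "\<lambda>u. if n dvd u then 0 else corr u ^ 2 - mean u"
  have eq: "(\<Sum>u\<in>{1..<t}. ?f u) = (\<Sum>\<rho>\<in>{0..<4}. \<Sum>u\<in>residue_class t \<rho>. ?f u)"
    unfolding residue_class_def by (rule sum.group[symmetric]) auto
  have "\<bar>\<Sum>\<rho>\<in>{0..<4}. \<Sum>u\<in>residue_class t \<rho>. ?f u\<bar> \<le> (\<Sum>\<rho>\<in>{0..<4::int}. disc_bound)"
    by (rule order.trans[OF sum_abs sum_mono]) (rule class_discrepancy_le)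
  then show ?thesis unfolding eq by simp
qed

theorem sum_corr_squares_estimate:
  fixes A c :: real
  assumes A_def: "A = (\<Sum>u\<in>{1..<t}. corr u ^ 2)" and c_def: "c = real_of_int t / real_of_int n"
  shows "\<bar>2 * A - (t ^ 2 + 4 * multiple_squares (q * n) t - 2 * multiple_squares q t / n)\<bar>
    \<le> 96 * c + 10 * c ^ 2 * t + 9 * c * t + t + 8 * disc_bound"
proof -
  define Z where "Z = (\<Sum>v\<in>{1..<t}. if n dvd v then sign_corr v ^ 2 else 0)"
  define Q where "Q = (\<Sum>v\<in>{1..<t}. sign_corr v ^ 2)"
  define V where "V = (\<Sum>v\<in>{1..<t}. if n dvd v then real_of_int (t - v) else 0)"
  define M where "M = (\<Sum>v\<in>{1..<t}. if n dvd v then mean v else 0)"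
  define D where "D = (\<Sum>u\<in>{1..<t}. if n dvd u then 0 else corr u ^ 2 - mean u)"
  define N where "N = real (card {v \<in> {1..<t}. n dvd v})"
  have N: "0 \<le> N" "N \<le> c"
    unfolding N_def c_def using card_multiples_le[OF n_pos t_ge] by auto
  have c0: "c \<ge> 0" using N by linarith
  have np: "real_of_int n > 0" using n_pos by simp
  have tp: "real_of_int t \<ge> 1" using t_ge by simp
  have filter_le: "(\<Sum>v\<in>{1..<t}. if n dvd v then f v else 0) \<le> N * C"
    if "\<And>v. v \<in> {1..<t} \<Longrightarrow> n dvd v \<Longrightarrow> f v \<le> C" for f C
  proof -
    have "(\<Sum>v\<in>{1..<t}. if n dvd v then f v else 0) = (\<Sum>v\<in>{v \<in> {1..<t}. n dvd v}. f v)"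
      by (rule sum.inter_filter[symmetric]) simp
    also have "\<dots> \<le> (\<Sum>v\<in>{v \<in> {1..<t}. n dvd v}. C)" by (rule sum_mono) (use that in auto)
    finally show ?thesis by (simp add: N_def)
  qed
  define S where "S = (\<Sum>u\<in>{1..<t}. mean u)"
  have AS: "A = Z + S - M + D"
    unfolding S_def    unfolding A_def Z_def M_def D_def sum.distrib[symmetric] sum_subtractf[symmetric]
    by (intro sum.cong refl) (simp add: corr_dvd)
  have nS: "n * S = (n + 1) * (t * (t - 1) / 2 + Z - V) - Q"
  proof -
    have "n * (\<Sum>u\<in>{1..<t}. mean u) = (n + 1) * (\<Sum>u\<in>{1..<t}. coincidences u) - Q"
      unfolding sum_distrib_left mean_eq Q_def by (simp add: sum_subtractf sum_distrib_left)
    moreover have "(\<Sum>v\<in>{1..<t}. if n dvd v then sign_corr v ^ 2 - of_int (t - v) else 0) = Z - V"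
      unfolding Z_def V_def sum_subtractf[symmetric] by (intro sum.cong) auto
    ultimately show ?thesis unfolding sum_coincidences S_def by (simp add: add_diff_eq)
  qed
  have "2 * n * A = 2 * n * Z + 2 * (n * S) - 2 * n * M + 2 * n * D"
    unfolding AS by (simp add: algebra_simps)
  then have nA: "2 * n * A = 2 * n * Z + (n + 1) * (t * (t - 1) + 2 * Z - 2 * V) - 2 * Q - 2 * n * M + 2 * n * D"
    unfolding nS by (simp add: field_simps)
  have Zb: "0 \<le> Z - multiple_squares (q * n) t" "Z - multiple_squares (q * n) t \<le> N * 16"
  proof -
    have cop: "q * n dvd v \<longleftrightarrow> q dvd v" if "n dvd v" for v
    proof -
      have "coprime (4::int) n"
        using odd_n coprime_power_left_iff[of 2 2 n] by (simp add: coprime_left_2_iff_odd)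
      then have "coprime q n" using q_dvd by (meson coprime_divisors dvd_refl)
      then show ?thesis using that by (meson divides_mult dvd_mult_left)
    qed
    have eq: "Z - multiple_squares (q * n) t =
        (\<Sum>v\<in>{1..<t}. if n dvd v then (if q dvd v then 0 else sign_corr v ^ 2) else 0)"
      unfolding Z_def multiple_squares_def sum_subtractf[symmetric]
      by (intro sum.cong refl) (auto simp: cop sign_corr_dvd dest: dvd_mult_right)
    show "0 \<le> Z - multiple_squares (q * n) t" unfolding eq by (intro sum_nonneg) auto
    show "Z - multiple_squares (q * n) t \<le> N * 16"
      unfolding eq by (rule filter_le) (auto simp: sign_corr_not_dvd)
  qed
  have Qb: "0 \<le> Q - multiple_squares q t" "Q - multiple_squares q t \<le> t * 16"
  proof -
    have eq: "Q - multiple_squares q t = (\<Sum>v\<in>{1..<t}. if q dvd v then 0 else sign_corr v ^ 2)"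
      unfolding Q_def multiple_squares_def sum_subtractf[symmetric]
      by (intro sum.cong refl) (auto simp: sign_corr_dvd)
    show "0 \<le> Q - multiple_squares q t" unfolding eq by (intro sum_nonneg) auto
    have "Q - multiple_squares q t \<le> (\<Sum>v\<in>{1..<t}. 16)"
      unfolding eq by (rule sum_mono) (auto simp: sign_corr_not_dvd)
    then show "Q - multiple_squares q t \<le> t * 16" using t_ge by simp
  qed
  have Vb: "0 \<le> V" "V \<le> N * t"
    unfolding V_def by (auto intro!: sum_nonneg filter_le)
  have "sign_corr v ^ 2 \<le> t ^ 2" if "v \<in> {1..<t}" for v
  proof -
    have "\<bar>sign_corr v\<bar> \<le> t" using abs_sign_corr_le[of v] that by auto
    then have "\<bar>sign_corr v\<bar> ^ 2 \<le> real_of_int t ^ 2" by (intro power_mono) auto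
    then show ?thesis by simp
  qed
  then have Z2: "0 \<le> Z" "Z \<le> N * t ^ 2"
    unfolding Z_def by (auto intro!: sum_nonneg filter_le)
  have Mb: "0 \<le> M" "M \<le> N * (2 * (t + 2 * (N * t)))"
  proof -
    show "0 \<le> M" unfolding M_def by (intro sum_nonneg) (auto simp: mean_nonneg)
    have "mean u \<le> 2 * (t + 2 * (N * t))" if u: "u \<in> {1..<t}" for u
    proof -
      have "(\<Sum>v\<in>{1..<t}. if n dvd v then (\<Sum>j\<in>{0..<t-v-u}. e v j * e v (j + u)) else 0) \<le> N * t"
      proof (rule filter_le)
        fix v assume v: "v \<in> {1..<t}"
        have "(\<Sum>j\<in>{0..<t-v-u}. e v j * e v (j + u)) \<le> (\<Sum>j\<in>{0..<t-v-u}. 1)"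
        proof (rule sum_mono)
          fix j
          have "\<bar>e v j * e v (j + u)\<bar> = 1" by (simp add: abs_mult abs_e)
          then show "e v j * e v (j + u) \<le> 1" by linarith
        qed
        also have "\<dots> \<le> t" using u v tp by simp linarith
        finally show "(\<Sum>j\<in>{0..<t-v-u}. e v j * e v (j + u)) \<le> t" .
      qed
      then have C: "coincidences u \<le> t + 2 * (N * t)" unfolding coincidences_eq[OF u] using u by simp
      have pos: "t + 2 * (N * t) \<ge> 0" using N tp by simp
      have "n * mean u \<le> (n + 1) * coincidences u" unfolding mean_eq by simp
      also have "\<dots> \<le> (n + 1) * (t + 2 * (N * t))" using C np by (intro mult_left_mono) auto
      also have "\<dots> \<le> (2 * n) * (t + 2 * (N * t))" using pos n_ge by (intro mult_right_mono) auto
      finally show ?thesis using np by simp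
    qed
    then show "M \<le> N * (2 * (t + 2 * (N * t)))" unfolding M_def by (intro filter_le) auto
  qed
  have Db: "\<bar>D\<bar> \<le> 4 * disc_bound" unfolding D_def by (rule discrepancy_sum_le)
  define Zd where "Zd = Z - multiple_squares (q * n) t"
  define Qd where "Qd = Q - multiple_squares q t"
  have "2 * A - (t ^ 2 + 4 * multiple_squares (q * n) t - 2 * multiple_squares q t / n)
     = 4 * Zd + 2 * (Z / n) + t * c - c - t - 2 * V - 2 * (V / n) - 2 * (Qd / n) - 2 * M + 2 * D"
  proof -
    have h: "t = n * c" "Z = n * (Z / n)" "V = n * (V / n)" "Q - multiple_squares q t = n * (Qd / n)"
      "multiple_squares q t = n * (multiple_squares q t / n)"
      using np by (simp_all add: c_def Qd_def)
    have "n * (2 * A - (t ^ 2 + 4 * multiple_squares (q * n) t - 2 * (multiple_squares q t / n)))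
      = n * (4 * Zd + 2 * (Z / n) + t * c - c - t - 2 * V - 2 * (V / n) - 2 * (Qd / n) - 2 * M + 2 * D)"
    proof -
      have gen: "\<nu> * (2 * A - (\<tau> ^ 2 + 4 * \<mu> - 2 * \<mu>')) =
          \<nu> * (4 * (Z - \<mu>) + 2 * z + \<tau> * c - c - \<tau> - 2 * V - 2 * v - 2 * \<delta> - 2 * M + 2 * D)"
        if "2 * \<nu> * A = 2 * \<nu> * Z + (\<nu> + 1) * (\<tau> * (\<tau> - 1) + 2 * Z - 2 * V) - 2 * Q - 2 * \<nu> * M + 2 * \<nu> * D"
          "\<tau> = \<nu> * c" "Z = \<nu> * z" "V = \<nu> * v" "Q - \<mu>q = \<nu> * \<delta>" "\<mu>q = \<nu> * \<mu>'"
        for \<nu> \<tau> \<mu> \<mu>' \<mu>q z v \<delta> :: real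
      proof -
        have Q: "Q = \<nu> * \<mu>' + \<nu> * \<delta>" using that(5,6) by simp
        have "\<nu> * (2 * A - (\<tau> ^ 2 + 4 * \<mu> - 2 * \<mu>')) = 2 * \<nu> * A - \<nu> * (\<tau> ^ 2 + 4 * \<mu> - 2 * \<mu>')"
          by (simp add: algebra_simps)
        also have "\<dots> = \<nu> * (4 * (Z - \<mu>) + 2 * z + \<tau> * c - c - \<tau> - 2 * V - 2 * v - 2 * \<delta> - 2 * M + 2 * D)"
          unfolding that(1) Q that(2,3,4) by (simp add: algebra_simps power2_eq_square)
        finally show ?thesis .
      qed
      show ?thesis
        using gen[OF _ h] nA unfolding Zd_def by simp
    qed
    then show ?thesis using np by simp
  qed
  moreover have "Zd \<le> 16 * c" "0 \<le> Zd" using Zb N by (auto simp: Zd_def)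
  moreover have "0 \<le> Z / n" "Z / n \<le> c ^ 2 * t"
  proof -
    show "0 \<le> Z / n" using Z2 np by simp
    have "N * t ^ 2 \<le> c * t ^ 2" using N(2) by (intro mult_right_mono) auto
    then have "Z / n \<le> (c * t ^ 2) / n"
      using Z2(2) np by (intro divide_right_mono) auto
    also have "\<dots> = c ^ 2 * t" using np by (simp add: c_def power2_eq_square)
    finally show "Z / n \<le> c ^ 2 * t" .
  qed
  moreover have V': "0 \<le> V" "V \<le> c * t"
  proof -
    have "N * t \<le> c * t" using N(2) tp by (intro mult_right_mono) auto
    then show "0 \<le> V" "V \<le> c * t" using Vb by auto
  qed
  moreover have "0 \<le> V / n" "V / n \<le> c * t"
  proof -
    show "0 \<le> V / n" using V' np by simp
    have "V / n \<le> V / 1" using V' n_ge by (intro divide_left_mono) auto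
    then show "V / n \<le> c * t" using V' by simp
  qed
  moreover have "0 \<le> Qd / n" "Qd / n \<le> 16 * c"
  proof -
    show "0 \<le> Qd / n" using Qb np by (simp add: Qd_def)
    have "Qd / n \<le> (t * 16) / n" using Qb(2) np unfolding Qd_def by (intro divide_right_mono) auto
    then show "Qd / n \<le> 16 * c" by (simp add: c_def mult.commute)
  qed
  moreover have "M \<le> 2 * (c * t) + 4 * (c ^ 2 * t)"
  proof -
    have "N * (2 * (t + 2 * (N * t))) \<le> c * (2 * (t + 2 * (c * t)))"
      using N c0 tp by (intro mult_mono add_mono) auto
    then show ?thesis using Mb(2) by (simp add: algebra_simps power2_eq_square)
  qed
  moreover note Mb(1) Db c0 tp
  moreover have "0 \<le> c * t" "0 \<le> c ^ 2 * t" using c0 tp by auto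
  moreover have "t * c = c * t" by (rule mult.commute)
  ultimately show ?thesis unfolding mult.assoc by linarith
qed

end

section \<open>The limit of the merit factor\<close>

lemma h_eq:
  assumes "T > 0"
  shows "h T = 1 / (1 - 2 * T / 3 + 4 * (square_sum T / T ^ 2))"
proof -
  obtain N where N: "T \<le> real N" using real_arch_simple by blast
  have "(\<Sum>k. (max 0 (1 - real (Suc k) / T)) ^ 2) = (\<Sum>k. (max 0 (T - real (Suc k))) ^ 2 / T ^ 2)"
    using max_diff_scale[OF assms] by (simp add: power_divide)
  also have "\<dots> = (\<Sum>k<N. (max 0 (T - real (Suc k))) ^ 2 / T ^ 2)"
    using N by (intro suminf_finite) (auto simp: max_def)
  also have "\<dots> = square_sum T / T ^ 2"
    by (simp add: square_sum_finite[OF N] sum_divide_distrib)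
  finally show ?thesis by (simp add: h_def)
qed

lemma tendsto_0_comparison:
  fixes f g :: "nat \<Rightarrow> real"
  assumes "\<forall>\<^sub>F d in sequentially. \<bar>f d\<bar> \<le> g d" "g \<longlonglongrightarrow> 0"
  shows "f \<longlonglongrightarrow> 0"
  by (rule tendsto_rabs_zero_cancel, rule tendsto_sandwich[OF _ assms(1) tendsto_const assms(2)]) simp

text \<open>
  For the ratio \<open>c = t/n\<close>, which tends to \<open>qT\<close>, the error of \<open>sum_corr_squares_estimate\<close> relative to \<open>t\<^sup>2\<close> is a sum of
  terms, each a power of \<open>c\<close> times a null function of \<open>n\<close>. This sum is \<open>B\<close> in the proof; \<open>E\<close> is the main term.
\<close>
theorem merit_factor_limit:
  fixes n t :: "nat \<Rightarrow> int" and q :: int and T :: real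
  assumes pat: "\<forall>\<^sub>F d in sequentially. sign_pattern (n d) (x d) (s d) (\<epsilon> d) q (t d)"
    and n: "filterlim (\<lambda>d. real_of_int (n d)) at_top sequentially"
    and lim: "(\<lambda>d. real_of_int (t d) / (real_of_int q * real_of_int (n d))) \<longlonglongrightarrow> T" and T: "T > 0"
  shows "(\<lambda>d. real_of_int (t d) ^ 2 / (2 * (\<Sum>u\<in>{1..<t d}. sign_pattern.corr (x d) (\<epsilon> d) (t d) u ^ 2))) \<longlonglongrightarrow> h T"
proof -
  define A where "A = (\<lambda>d. \<Sum>u\<in>{1..<t d}. sign_pattern.corr (x d) (\<epsilon> d) (t d) u ^ 2)"
  define m where "m = (\<lambda>d. real_of_int (n d))"
  define \<tau> where "\<tau> = (\<lambda>d. real_of_int (t d))"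
  define \<kappa> where "\<kappa> = (\<lambda>d. real_of_int (t d) / (real_of_int q * real_of_int (n d)))"
  define c where "c = (\<lambda>d. \<tau> d / m d)"
  define \<Lambda> where "\<Lambda> = (\<lambda>d. 1 + ln (m d))"
  \<comment> \<open>The terms bound the relative error in \<open>sum_corr_squares_estimate\<close>, with \<open>t = c n\<close> and \<open>inv_sum \<le> 2 n (1 + ln n)\<close>.\<close>
  define B where "B = (\<lambda>d. 96 / c d * (1 / m d ^ 2) + 10 * c d * (1 / m d) + 9 / m d + 1 / c d * (1 / m d)
     + 2048 / c d * ((m d + 1) * sqrt (m d + 1) * (1 + ln (m d)) ^ 2 / m d ^ 2)
     + 8192 / c d ^ 2 * ((m d + 1) * sqrt (m d + 1) * (1 + ln (m d)) ^ 3 / m d ^ 2)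
     + 256 * (sqrt (m d + 1) * (1 + ln (m d)) / m d))"
  define E where "E = (\<lambda>d. 1 + 4 * (square_sum (\<kappa> d) / \<kappa> d ^ 2) - 2 * (multiple_squares q (t d) / (m d * \<tau> d ^ 2)))"
  have n': "filterlim m at_top sequentially" using n by (simp add: m_def)
  have q_pos: "q > 0"
  proof -
    obtain d where "sign_pattern (n d) (x d) (s d) (\<epsilon> d) q (t d)"
      using eventually_happens[OF pat] by auto
    then show ?thesis by (rule sign_pattern.q_pos)
  qed
  have \<kappa>: "\<kappa> \<longlonglongrightarrow> T" using lim by (simp add: \<kappa>_def)
  have "(\<lambda>d. q * \<kappa> d) \<longlonglongrightarrow> q * T" by (intro tendsto_intros \<kappa>)
  moreover have "q * \<kappa> d = c d" for d
    using q_pos by (simp add: \<kappa>_def c_def \<tau>_def m_def)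
  ultimately have c: "c \<longlonglongrightarrow> q * T" by simp
  have qT: "q * T > 0" using q_pos T by simp
  have B: "B \<longlonglongrightarrow> 0"
  proof -
    have 1: "((\<lambda>y::real. 1 / y ^ 2) \<longlongrightarrow> 0) at_top" "((\<lambda>y::real. 1 / y) \<longlongrightarrow> 0) at_top"
      "((\<lambda>y::real. 9 / y) \<longlongrightarrow> 0) at_top"
      "((\<lambda>y::real. (y + 1) * sqrt (y + 1) * (1 + ln y) ^ 2 / y ^ 2) \<longlongrightarrow> 0) at_top"
      "((\<lambda>y::real. (y + 1) * sqrt (y + 1) * (1 + ln y) ^ 3 / y ^ 2) \<longlongrightarrow> 0) at_top"
      "((\<lambda>y::real. sqrt (y + 1) * (1 + ln y) / y) \<longlongrightarrow> 0) at_top"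
      by real_asymp+
    note 2 = 1[THEN filterlim_compose, OF n']
    have "B \<longlonglongrightarrow> 96 / (q * T) * 0 + 10 * (q * T) * 0 + 0 + 1 / (q * T) * 0
        + 2048 / (q * T) * 0 + 8192 / (q * T) ^ 2 * 0 + 256 * 0"
      unfolding B_def using qT by (intro tendsto_intros c 2) auto
    then show ?thesis by simp
  qed
  have ev: "\<forall>\<^sub>F d in sequentially. \<bar>2 * A d / \<tau> d ^ 2 - E d\<bar> \<le> B d
      \<and> \<bar>multiple_squares q (t d) / (m d * \<tau> d ^ 2) - \<kappa> d / 3\<bar> \<le> 1 / m d"
    using pat order_tendstoD(1)[OF c qT]
  proof eventually_elim
    case (elim d)
    interpret sign_pattern "n d" "x d" "s d" "\<epsilon> d" q "t d" by (rule elim)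
    have mp: "m d \<ge> 2" using n_ge by (simp add: m_def)
    have tp: "\<tau> d \<ge> 1" using t_ge by (simp add: \<tau>_def)
    have cp: "c d > 0" by (rule elim)
    have tc: "\<tau> d = c d * m d" using mp by (simp add: c_def)
    have L: "\<Lambda> d \<ge> 1" using mp by (simp add: \<Lambda>_def)
    define r where "r = sqrt (m d + 1)"
    have r: "r > 0" using mp by (simp add: r_def)
    have S: "0 \<le> inv_sum" "inv_sum \<le> 2 * m d * \<Lambda> d"
      using inv_sum_nonneg inv_sum_le by (auto simp: m_def \<Lambda>_def)
    have db: "disc_bound = (64 * (m d + 1) * (r * (\<tau> d + 2 * inv_sum) / m d) * inv_sum ^ 2
     + 16 * r * \<tau> d ^ 2 * inv_sum) / m d ^ 2"
      by (simp add: disc_bound_def m_def \<tau>_def r_def)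
    also have "\<dots> \<le> (64 * (m d + 1) * (r * (\<tau> d + 2 * (2 * m d * \<Lambda> d)) / m d) * (2 * m d * \<Lambda> d) ^ 2
     + 16 * r * \<tau> d ^ 2 * (2 * m d * \<Lambda> d)) / m d ^ 2"
      using S r mp tp L
      by (intro divide_right_mono add_mono mult_mono power_mono mult_nonneg_nonneg divide_nonneg_nonneg) auto
    also have "\<dots> = \<tau> d ^ 2 * (256 / c d * ((m d + 1) * r * \<Lambda> d ^ 2 / m d ^ 2)
      + 1024 / c d ^ 2 * ((m d + 1) * r * \<Lambda> d ^ 3 / m d ^ 2) + 32 * (r * \<Lambda> d / m d))"
      using cp mp unfolding tc by (simp add: field_simps power2_eq_square power3_eq_cube)
    finally have db': "disc_bound \<le> \<tau> d ^ 2 * (256 / c d * ((m d + 1) * r * \<Lambda> d ^ 2 / m d ^ 2)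
      + 1024 / c d ^ 2 * ((m d + 1) * r * \<Lambda> d ^ 3 / m d ^ 2) + 32 * (r * \<Lambda> d / m d))" .
    have rest: "96 * c d + 10 * c d ^ 2 * \<tau> d + 9 * c d * \<tau> d + \<tau> d =
       \<tau> d ^ 2 * (96 / c d * (1 / m d ^ 2) + 10 * c d * (1 / m d) + 9 / m d + 1 / c d * (1 / m d))"
      using cp mp unfolding tc by (simp add: field_simps power2_eq_square)
    have "\<bar>2 * A d - (\<tau> d ^ 2 + 4 * multiple_squares (q * n d) (t d) - 2 * multiple_squares q (t d) / m d)\<bar>
       \<le> 96 * c d + 10 * c d ^ 2 * \<tau> d + 9 * c d * \<tau> d + \<tau> d + 8 * disc_bound"
      using sum_corr_squares_estimate[of "A d" "c d"] by (simp add: A_def c_def m_def \<tau>_def)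
    also have "\<dots> \<le> \<tau> d ^ 2 * B d"
    proof -
      have "\<tau> d ^ 2 * B d = \<tau> d ^ 2 * (96 / c d * (1 / m d ^ 2) + 10 * c d * (1 / m d) + 9 / m d + 1 / c d * (1 / m d))
        + 8 * (\<tau> d ^ 2 * (256 / c d * ((m d + 1) * r * \<Lambda> d ^ 2 / m d ^ 2)
          + 1024 / c d ^ 2 * ((m d + 1) * r * \<Lambda> d ^ 3 / m d ^ 2) + 32 * (r * \<Lambda> d / m d)))"
        unfolding B_def r_def \<Lambda>_def by (simp add: algebra_simps)
      then show ?thesis using db' unfolding rest by linarith
    qed
    finally have main: "\<bar>2 * A d - (\<tau> d ^ 2 + 4 * multiple_squares (q * n d) (t d) - 2 * multiple_squares q (t d) / m d)\<bar>
      \<le> \<tau> d ^ 2 * B d" .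
    have ms: "multiple_squares (q * n d) (t d) = \<tau> d ^ 2 * (square_sum (\<kappa> d) / \<kappa> d ^ 2)"
      using q_pos n_pos t_ge mp by (subst multiple_squares_eq) (auto simp: \<kappa>_def \<tau>_def power_divide power_mult_distrib)
    have "\<tau> d ^ 2 + 4 * multiple_squares (q * n d) (t d) - 2 * multiple_squares q (t d) / m d = \<tau> d ^ 2 * E d"
      unfolding ms E_def using tp mp by (simp add: field_simps)
    then have "\<bar>\<tau> d ^ 2 * (2 * A d / \<tau> d ^ 2 - E d)\<bar> \<le> \<tau> d ^ 2 * B d"
      using main tp by (simp add: right_diff_distrib)
    then have 1: "\<bar>2 * A d / \<tau> d ^ 2 - E d\<bar> \<le> B d"
      using tp by (simp add: abs_mult)
    have pos: "m d * \<tau> d ^ 2 > 0" using mp tp by simp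
    have "multiple_squares q (t d) / (m d * \<tau> d ^ 2) \<le> (\<tau> d ^ 3 / (3 * q)) / (m d * \<tau> d ^ 2)"
      using multiple_squares_bounds(2)[of q "t d"] q_pos t_ge pos
      by (intro divide_right_mono) (auto simp: \<tau>_def)
    also have "\<dots> = \<kappa> d / 3"
      using tp mp q_pos by (simp add: \<kappa>_def flip: \<tau>_def m_def) (simp add: \<tau>_def m_def field_simps power3_eq_cube power2_eq_square)
    finally have up: "multiple_squares q (t d) / (m d * \<tau> d ^ 2) \<le> \<kappa> d / 3" .
    have "(\<tau> d ^ 3 / (3 * q) - \<tau> d ^ 2 / 2) / (m d * \<tau> d ^ 2) \<le> multiple_squares q (t d) / (m d * \<tau> d ^ 2)"
      using multiple_squares_bounds(1)[of q "t d"] q_pos t_ge pos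
      by (intro divide_right_mono) (auto simp: \<tau>_def)
    moreover have "(\<tau> d ^ 3 / (3 * q) - \<tau> d ^ 2 / 2) / (m d * \<tau> d ^ 2) = \<kappa> d / 3 - 1 / (2 * m d)"
      using tp mp q_pos by (simp add: \<kappa>_def \<tau>_def m_def field_simps power3_eq_cube power2_eq_square)
    moreover have "1 / (2 * m d) \<le> 1 / m d" using mp by (simp add: field_simps)
    moreover have "1 / m d \<ge> 0" using mp by simp
    ultimately have "\<bar>multiple_squares q (t d) / (m d * \<tau> d ^ 2) - \<kappa> d / 3\<bar> \<le> 1 / m d" using up by linarith
    with 1 show ?case by blast
  qed
  \<comment> \<open>The squares at multiples of \<open>q\<close>: their sum is \<open>t\<^sup>3/(3q)\<close> up to \<open>t\<^sup>2\<close>, whence the term \<open>-2T/3\<close>.\<close>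
  have "(\<lambda>d. 1 / m d) \<longlonglongrightarrow> 0"
    by (rule filterlim_compose[OF _ n']) real_asymp
  then have "(\<lambda>d. multiple_squares q (t d) / (m d * \<tau> d ^ 2) - \<kappa> d / 3) \<longlonglongrightarrow> 0"
    by (rule tendsto_0_comparison[rotated]) (use ev in \<open>auto elim: eventually_mono\<close>)
  then have "(\<lambda>d. (multiple_squares q (t d) / (m d * \<tau> d ^ 2) - \<kappa> d / 3) + \<kappa> d / 3) \<longlonglongrightarrow> 0 + T / 3"
    by (intro tendsto_intros \<kappa>) auto
  then have ms: "(\<lambda>d. multiple_squares q (t d) / (m d * \<tau> d ^ 2)) \<longlonglongrightarrow> T / 3" by simp
  have "E \<longlonglongrightarrow> 1 + 4 * (square_sum T / T ^ 2) - 2 * (T / 3)"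
    unfolding E_def using T by (intro tendsto_intros \<kappa> ms square_sum_tendsto) auto
  moreover have "(\<lambda>d. 2 * A d / \<tau> d ^ 2 - E d) \<longlonglongrightarrow> 0"
    by (rule tendsto_0_comparison[OF _ B]) (use ev in \<open>auto elim: eventually_mono\<close>)
  ultimately have "(\<lambda>d. (2 * A d / \<tau> d ^ 2 - E d) + E d) \<longlonglongrightarrow> 0 + (1 + 4 * (square_sum T / T ^ 2) - 2 * (T / 3))"
    by (intro tendsto_add)
  then have lim2: "(\<lambda>d. 2 * A d / \<tau> d ^ 2) \<longlonglongrightarrow> 1 - 2 * T / 3 + 4 * (square_sum T / T ^ 2)"
    by (simp add: algebra_simps)
  have "(\<lambda>d. 1 / (2 * A d / \<tau> d ^ 2)) \<longlonglongrightarrow> h T"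
    unfolding h_eq[OF T] using limit_value_pos[OF T] by (intro tendsto_divide tendsto_const lim2) auto
  then show ?thesis by (simp add: A_def \<tau>_def)
qed

section \<open>Galois sequences\<close>

lemma (in UP_cring) eval_finsum:
  assumes f: "f \<in> A \<rightarrow> carrier P" and x: "x \<in> carrier R"
  shows "eval R R id x (finsum P f A) = finsum R (\<lambda>i. eval R R id x (f i)) A"
proof -
  interpret UP_pre_univ_prop R R id by unfold_locales simp
  interpret ring_hom_cring P R "eval R R id x" by unfold_locales (rule eval_ring_hom[OF x])
  show ?thesis using hom_finsum[OF f] by (simp only: comp_def)
qed

locale galois_field = field K for K (structure) +
  fixes d :: nat and \<theta> :: 'a
  assumes d_pos: "d \<ge> 1" and card_carrier: "card (carrier K) = 2 ^ d"
    and primitive: "primitive_element K \<theta>"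
begin

lemma finite_carrier: "finite (carrier K)"
  using card_carrier by (metis card.infinite power_not_zero zero_neq_numeral)

lemma pow_nonzero: "a \<in> carrier K \<Longrightarrow> a \<noteq> \<zero> \<Longrightarrow> a [^] (k::nat) \<noteq> \<zero>"
  by (induction k) (auto simp: integral_iff)

text \<open>
  The order of the additive group is a power of 2, and \<open>2\<^sup>d \<cdot> 1\<close> is the \<open>d\<close>-th power of \<open>1 + 1\<close>.
\<close>
lemma one_plus_one: "\<one> \<oplus> \<one> = \<zero>"
proof -
  have "add_pow K ((2::nat) ^ k) \<one> = (\<one> \<oplus> \<one>) [^] k" for k :: nat
  proof (induction k)
    case (Suc k)
    have "add_pow K ((2::nat) ^ Suc k) \<one> = add_pow K ((2::nat) ^ k) \<one> \<oplus> add_pow K ((2::nat) ^ k) \<one>"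
      by (simp add: add.nat_pow_mult mult_2)
    also have "\<dots> = (\<one> \<oplus> \<one>) [^] k \<otimes> (\<one> \<oplus> \<one>)"
      unfolding Suc by (simp add: r_distr)
    finally show ?case by simp
  qed simp
  moreover have "add_pow K ((2::nat) ^ d) \<one> = \<zero>"
    using add.pow_order_eq_1[of \<one>] card_carrier by (simp add: Coset.order_def)
  ultimately have "(\<one> \<oplus> \<one>) [^] d = \<zero>" by metis
  then show ?thesis using pow_nonzero[of "\<one> \<oplus> \<one>" d] by auto
qed

lemma add_self: "a \<in> carrier K \<Longrightarrow> a \<oplus> a = \<zero>"
  using r_distr[of \<one> \<one> a] one_plus_one by (metis l_distr l_null l_one one_closed)

lemma frobenius_add_2:
  assumes "a \<in> carrier K" "b \<in> carrier K"
  shows "(a \<oplus> b) [^] (2::nat) = a [^] (2::nat) \<oplus> b [^] (2::nat)"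
proof -
  have "(a \<oplus> b) [^] (2::nat) = (a \<otimes> a \<oplus> b \<otimes> b) \<oplus> (a \<otimes> b \<oplus> a \<otimes> b)"
    using assms by (simp add: numeral_2_eq_2 l_distr r_distr a_ac m_comm)
  then show ?thesis using assms by (simp add: add_self numeral_2_eq_2)
qed

lemma pow_two_pow_Suc: "a \<in> carrier K \<Longrightarrow> a [^] ((2::nat) ^ Suc j) = (a [^] ((2::nat) ^ j)) [^] (2::nat)"
  by (simp add: nat_pow_pow mult.commute)

lemma frobenius_add:
  assumes "a \<in> carrier K" "b \<in> carrier K"
  shows "(a \<oplus> b) [^] ((2::nat) ^ j) = a [^] ((2::nat) ^ j) \<oplus> b [^] ((2::nat) ^ j)"
proof (induction j)
  case 0
  then show ?case using assms by (simp add: nat_pow_eone)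
next
  case (Suc j)
  then show ?case using assms by (simp only: pow_two_pow_Suc a_closed frobenius_add_2 nat_pow_closed)
qed

lemma frobenius_finsum:
  assumes "finite A" "f \<in> A \<rightarrow> carrier K"
  shows "(finsum K f A) [^] (2::nat) = finsum K (\<lambda>i. f i [^] (2::nat)) A"
  using assms
proof (induction A rule: finite_induct)
  case (insert a A)
  have "finsum K f (insert a A) = f a \<oplus> finsum K f A"
    using insert by (intro finsum_insert) auto
  moreover have "finsum K (\<lambda>i. f i [^] (2::nat)) (insert a A) = f a [^] (2::nat) \<oplus> finsum K (\<lambda>i. f i [^] (2::nat)) A"
    using insert by (intro finsum_insert) auto
  moreover have "f \<in> A \<rightarrow> carrier K" "f a \<in> carrier K" using insert by auto
  ultimately show ?case using insert by (simp add: frobenius_add_2)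
qed (simp add: nat_pow_zero)

lemma mult_group: "group (mult_of K)" by (rule field_mult_group)

lemma theta_carrier: "\<theta> \<in> carrier K" "\<theta> \<noteq> \<zero>"
  using primitive by (auto simp: primitive_element_def)

definition n :: nat where "n = 2 ^ d - 1"

lemma n_pos: "n \<ge> 1"
  using d_pos power_increasing[of 1 d "2::nat"] by (simp add: n_def)

lemma card_nonzero: "card (carrier K - {\<zero>}) = n"
  using card_carrier finite_carrier by (simp add: n_def card_Diff_subset)

lemma pow_n_eq_one: "y \<in> carrier K \<Longrightarrow> y \<noteq> \<zero> \<Longrightarrow> y [^] n = \<one>"
  using group.pow_order_eq_1[OF mult_group, of y] card_nonzero
  by (simp add: Coset.order_def nat_pow_mult_of)

lemma pow_card: "y \<in> carrier K \<Longrightarrow> y [^] ((2::nat) ^ d) = y"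
proof (cases "y = \<zero>")
  case False
  assume y: "y \<in> carrier K"
  have "(2::nat) ^ d = Suc n" using n_pos by (simp add: n_def)
  then show ?thesis using False y pow_n_eq_one by simp
qed (simp add: nat_pow_zero)

lemma theta_surj:
  assumes "y \<in> carrier K" "y \<noteq> \<zero>"
  shows "\<exists>i. \<theta> [^] (i::nat) = y"
proof -
  interpret M: group "mult_of K" by (rule mult_group)
  have th: "\<theta> \<in> carrier (mult_of K)" using theta_carrier by simp
  have "M.ord \<theta> \<noteq> 0"
    using M.ord_ge_1[of \<theta>] th finite_carrier by simp
  then have "carrier (mult_of K) = {\<theta> [^]\<^bsub>mult_of K\<^esub> k | k. k \<in> (UNIV :: nat set)}"
    using M.generate_pow_nat[OF th] primitive by (simp add: primitive_element_def)
  moreover have "y \<in> carrier (mult_of K)" using assms by simp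
  ultimately show ?thesis by (simp only:) (auto simp: nat_pow_mult_of)
qed

text \<open>
  The powers of \<open>\<theta>\<close> as a function on the integers, through the least nonnegative residue of the exponent.
\<close>
definition power_at :: "int \<Rightarrow> 'a" where
  "power_at k = \<theta> [^] nat (k mod int n)"

lemma power_at_carrier: "power_at k \<in> carrier K" "power_at k \<noteq> \<zero>"
  using theta_carrier by (auto simp: power_at_def pow_nonzero)

lemma theta_pow_mod: "\<theta> [^] (i mod n) = \<theta> [^] i"
proof -
  have "\<theta> [^] i = (\<theta> [^] n) [^] (i div n) \<otimes> \<theta> [^] (i mod n)"
    using theta_carrier by (simp add: nat_pow_pow nat_pow_mult mult.commute[of n])
  then show ?thesis using theta_carrier pow_n_eq_one[of \<theta>] by simp
qed

lemma power_at_nat: "power_at (int i) = \<theta> [^] i"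
  by (simp add: power_at_def theta_pow_mod flip: zmod_int)

lemma power_at_periodic: "power_at (k + int n) = power_at k"
  by (simp add: power_at_def)

lemma power_at_add: "power_at (j + k) = power_at j \<otimes> power_at k"
proof -
  have "power_at (j + k) = power_at (int (nat (j mod int n) + nat (k mod int n)))"
    using n_pos by (simp add: power_at_def mod_add_eq)
  also have "\<dots> = power_at j \<otimes> power_at k"
    unfolding power_at_nat using theta_carrier by (simp add: power_at_def nat_pow_mult)
  finally show ?thesis .
qed

lemma power_at_bij: "bij_betw power_at {0..<int n} (carrier K - {\<zero>})"
proof -
  have img: "power_at ` {0..<int n} = carrier K - {\<zero>}"
  proof
    show "power_at ` {0..<int n} \<subseteq> carrier K - {\<zero>}" using power_at_carrier by auto
    show "carrier K - {\<zero>} \<subseteq> power_at ` {0..<int n}"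
    proof
      fix y assume "y \<in> carrier K - {\<zero>}"
      then obtain i where "\<theta> [^] (i::nat) = y" using theta_surj by auto
      then have "y = power_at (int i mod int n)" using power_at_nat[of i] by (simp add: power_at_def)
      then show "y \<in> power_at ` {0..<int n}" using n_pos by auto
    qed
  qed
  then have "inj_on power_at {0..<int n}"
    using card_nonzero by (intro eq_card_imp_inj_on) auto
  then show ?thesis using img by (simp add: bij_betw_def)
qed

lemma trace_closed: "y \<in> carrier K \<Longrightarrow> abs_trace K d y \<in> carrier K"
  unfolding abs_trace_def by (intro finsum_closed) auto

lemma trace_add:
  assumes "a \<in> carrier K" "b \<in> carrier K"
  shows "abs_trace K d (a \<oplus> b) = abs_trace K d a \<oplus> abs_trace K d b"
proof -
  have "abs_trace K d (a \<oplus> b) = finsum K (\<lambda>j. a [^] ((2::nat) ^ j) \<oplus> b [^] ((2::nat) ^ j)) {..<d}"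
    unfolding abs_trace_def using assms by (intro finsum_cong') (auto simp: frobenius_add)
  also have "\<dots> = abs_trace K d a \<oplus> abs_trace K d b"
    unfolding abs_trace_def using assms by (intro finsum_addf) auto
  finally show ?thesis .
qed

lemma trace_0: "abs_trace K d \<zero> = \<zero>"
  using trace_add[of \<zero> \<zero>] trace_closed[of \<zero>] by (metis add_self l_zero zero_closed)

text \<open>
  Frobenius permutes the terms of the trace cyclically, so the trace is a root of \<open>t\<^sup>2 = t\<close>.
\<close>
lemma trace_values:
  assumes y: "y \<in> carrier K"
  shows "abs_trace K d y = \<zero> \<or> abs_trace K d y = \<one>"
proof -
  let ?t = "abs_trace K d y" and ?f = "\<lambda>j. y [^] ((2::nat) ^ j)"
  obtain k where k: "d = Suc k" using d_pos by (cases d) auto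
  have fc: "?f \<in> A \<rightarrow> carrier K" for A using y by auto
  have t: "?t = finsum K ?f {..k}" by (simp add: abs_trace_def k lessThan_Suc_atMost)
  have "?t [^] (2::nat) = finsum K (\<lambda>j. ?f (Suc j)) {..k}"
    unfolding t using y by (subst frobenius_finsum) (auto intro!: finsum_cong' simp: nat_pow_pow mult.commute)
  moreover have "finsum K (\<lambda>j. ?f (Suc j)) {..k} \<oplus> ?f 0 = ?f (Suc k) \<oplus> finsum K ?f {..k}"
    using finsum_Suc[of ?f k] finsum_Suc2[of ?f k] fc by simp
  moreover have "?f (Suc k) = y" "?f 0 = y" using pow_card[OF y] y k by auto
  moreover have "finsum K (\<lambda>j. ?f (Suc j)) {..k} \<in> carrier K" "finsum K ?f {..k} \<in> carrier K"
    using y by (auto intro!: finsum_closed)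
  ultimately have "?t [^] (2::nat) = ?t"
    using y t by (metis a_comm add.right_cancel)
  then have "?t \<otimes> ?t = ?t \<otimes> \<one>" using trace_closed[OF y] by (simp add: numeral_2_eq_2)
  then show ?thesis using trace_closed[OF y] by (metis m_lcancel one_closed)
qed

text \<open>
  The trace is a polynomial function of degree \<open>2\<^sup>d\<^sup>-\<^sup>1\<close>, too small to vanish on all \<open>2\<^sup>d\<close> elements.
\<close>
lemma trace_nontrivial: "\<exists>y\<in>carrier K. abs_trace K d y \<noteq> \<zero>"
proof (rule ccontr)
  assume "\<not> ?thesis"
  then have all0: "abs_trace K d y = \<zero>" if "y \<in> carrier K" for y using that by blast
  interpret U: UP_domain K "UP K" by unfold_locales
  obtain k where k: "d = Suc k" using d_pos by (cases d) auto
  define f where "f = finsum (UP K) (\<lambda>j. up_ring.monom (UP K) \<one> ((2::nat) ^ j)) {..<d}"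
  have mon: "(\<lambda>j. up_ring.monom (UP K) \<one> ((2::nat) ^ j)) \<in> A \<rightarrow> carrier (UP K)" for A by auto
  have f: "f \<in> carrier (UP K)" unfolding f_def by (intro U.P.finsum_closed mon)
  have cf: "up_ring.coeff (UP K) f i = finsum K (\<lambda>j. if i = (2::nat) ^ j then \<one> else \<zero>) {..<d}" for i
    unfolding f_def using mon by (subst U.coeff_finsum) (auto intro!: finsum_cong')
  have "up_ring.coeff (UP K) f (2 ^ k) = finsum K (\<lambda>j. if k = j then \<one> else \<zero>) {..<d}"
    unfolding cf by (intro finsum_cong') auto
  also have "\<dots> = \<one>" using add.finprod_singleton[of k "{..<d}" "\<lambda>_. \<one>"] k by simp
  finally have nz: "f \<noteq> \<zero>\<^bsub>UP K\<^esub>" by auto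
  have "deg K f \<le> 2 ^ k"
  proof (rule U.deg_aboveI[OF _ f])
    fix m :: nat assume m: "2 ^ k < m"
    have "m \<noteq> 2 ^ j" if "j < d" for j
      using m that k power_increasing[of j k "2::nat"] by auto
    then show "up_ring.coeff (UP K) f m = \<zero>"
      unfolding cf by (intro add.finprod_one_eqI) auto
  qed
  moreover have ev: "eval K K id a f = \<zero>" if a: "a \<in> carrier K" for a
  proof -
    have "eval K K id a f = finsum K (\<lambda>j. eval K K id a (up_ring.monom (UP K) \<one> ((2::nat) ^ j))) {..<d}"
      unfolding f_def by (rule U.eval_finsum[OF mon a])
    also have "\<dots> = abs_trace K d a"
      unfolding abs_trace_def using a by (intro finsum_cong') (auto simp: U.evalRR_monom)
    finally show ?thesis using all0[OF a] by simp
  qed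
  ultimately have "card (carrier K) \<le> 2 ^ k"
    using U.roots_bound[OF f nz finite_carrier] by (simp add: ev cong: conj_cong)
  then show False by (simp add: card_carrier k)
qed

lemma add_char_mult:
  assumes "a \<in> carrier K" "b \<in> carrier K"
  shows "add_char K d (a \<oplus> b) = add_char K d a * add_char K d b"
  using trace_values[OF assms(1)] trace_values[OF assms(2)] one_plus_one
  by (auto simp: add_char_def trace_add[OF assms])

text \<open>
  Translation by an element of trace 1 changes the sign of the sum.
\<close>
lemma sum_add_char: "(\<Sum>y\<in>carrier K. add_char K d y) = 0"
proof -
  obtain b where b: "b \<in> carrier K" "abs_trace K d b \<noteq> \<zero>" using trace_nontrivial by blast
  have bij: "bij_betw (\<lambda>y. y \<oplus> b) (carrier K) (carrier K)"
    by (rule bij_betw_byWitness[where f' = "\<lambda>y. y \<oplus> b"]) (use b in \<open>auto simp: a_assoc add_self\<close>)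
  have "(\<Sum>y\<in>carrier K. add_char K d y) = (\<Sum>y\<in>carrier K. add_char K d (y \<oplus> b))"
    using sum.reindex_bij_betw[OF bij, of "add_char K d"] by simp
  also have "\<dots> = - (\<Sum>y\<in>carrier K. add_char K d y)"
    using b by (simp add: add_char_mult add_char_def[of K d b] sum_negf)
  finally show ?thesis by simp
qed

definition m_seq :: "int \<Rightarrow> int" where
  "m_seq k = add_char K d (power_at k)"

definition zech :: "int \<Rightarrow> int" where
  "zech u = int (SOME i. \<theta> [^] (i::nat) = \<one> \<oplus> power_at u)"

lemma power_at_eq_one:
  assumes "power_at u = \<one>"
  shows "int n dvd u"
proof -
  have "power_at (u mod int n) = power_at 0" "u mod int n \<in> {0..<int n}" "0 \<in> {0..<int n}"
    using assms n_pos by (auto simp: power_at_def)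
  then have "u mod int n = 0" using power_at_bij by (auto simp: bij_betw_def dest: inj_onD)
  then show ?thesis by auto
qed

lemma m_seq_square: "m_seq k * m_seq k = 1"
  by (simp add: m_seq_def add_char_def)

lemma m_seq_mult:
  assumes u: "\<not> int n dvd u"
  shows "m_seq j * m_seq (j + u) = m_seq (j + zech u)"
proof -
  have nz: "\<one> \<oplus> power_at u \<noteq> \<zero>"
  proof
    assume "\<one> \<oplus> power_at u = \<zero>"
    then have "power_at u = \<one>"
      using power_at_carrier(1)[of u] add_self[of "power_at u"] by (metis add.right_cancel one_closed)
    then show False using power_at_eq_one u by blast
  qed
  have "\<theta> [^] (SOME i::nat. \<theta> [^] i = \<one> \<oplus> power_at u) = \<one> \<oplus> power_at u"
    by (rule someI_ex[OF theta_surj]) (use nz power_at_carrier in auto)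
  then have z: "power_at (zech u) = \<one> \<oplus> power_at u" by (simp add: zech_def power_at_nat)
  have "m_seq j * m_seq (j + u) = add_char K d (power_at j \<oplus> power_at j \<otimes> power_at u)"
    using power_at_carrier by (simp add: m_seq_def power_at_add add_char_mult)
  also have "power_at j \<oplus> power_at j \<otimes> power_at u = power_at (j + zech u)"
    using power_at_carrier by (simp add: power_at_add z r_distr)
  finally show ?thesis by (simp add: m_seq_def)
qed

lemma m_seq_sum: "(\<Sum>k\<in>{0..<int n}. m_seq k) = - 1"
proof -
  have "(\<Sum>k\<in>{0..<int n}. m_seq k) = (\<Sum>y\<in>carrier K - {\<zero>}. add_char K d y)"
    unfolding m_seq_def by (rule sum.reindex_bij_betw[OF power_at_bij])
  also have "\<dots> = (\<Sum>y\<in>carrier K. add_char K d y) - add_char K d \<zero>"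
    using finite_carrier by (simp add: sum_diff1)
  finally show ?thesis by (simp add: sum_add_char add_char_def[of K d \<zero>] trace_0)
qed

text \<open>
  Multiplicativity of the character gives \<open>x\<^sub>j x\<^sub>j\<^sub>+\<^sub>u = \<psi>(\<theta>\<^sup>j (1 + \<theta>\<^sup>u))\<close>, and \<open>1 + \<theta>\<^sup>u\<close> is again a power of \<open>\<theta>\<close>. All
  properties survive a rotation by \<open>r\<close>, so results on pieces that start at index 0 cover those that start at \<open>r\<close>.
\<close>
theorem shift_and_add_m_seq:
  assumes "d \<ge> 2"
  shows "shift_and_add (int n) (\<lambda>k. real_of_int (m_seq (k + r))) zech"
proof
  have "(2::nat) ^ 2 \<le> 2 ^ d" using assms by (intro power_increasing) auto
  then have "2 \<le> n" unfolding n_def by simp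
  then show "2 \<le> int n" by simp
  have "even ((2::nat) ^ d)" using assms by simp
  then show "odd (int n)" using n_pos by (simp add: n_def)
  have per: "m_seq (k + int n) = m_seq k" for k by (simp add: m_seq_def power_at_periodic)
  show "real_of_int (m_seq (k + int n + r)) = real_of_int (m_seq (k + r))" for k
    using per[of "k + r"] by (simp add: ac_simps)
  show "real_of_int (m_seq (k + r)) * real_of_int (m_seq (k + r)) = 1" for k
    by (simp add: m_seq_square flip: of_int_mult)
  show "real_of_int (m_seq (j + r)) * real_of_int (m_seq (j + u + r)) = real_of_int (m_seq (j + zech u + r))"
    if "\<not> int n dvd u" for u j
    using m_seq_mult[OF that, of "j + r"] by (simp add: ac_simps flip: of_int_mult)
  show "zech (u + int n) = zech u" for u by (simp add: zech_def power_at_periodic)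
  have "(\<Sum>k\<in>{0..<int n}. m_seq (k + r)) = - 1"
    using sum_periodic_shift[of "int n" m_seq r] n_pos per m_seq_sum by simp
  then show "(\<Sum>k\<in>{0..<int n}. real_of_int (m_seq (k + r))) = - 1"
    by (simp flip: of_int_sum)
qed

end

section \<open>Sign patterns and polynomials\<close>

lemma coeff_sum_monom:
  fixes f :: "nat \<Rightarrow> 'b::comm_ring_1"
  shows "Polynomial.coeff (\<Sum>j<t. Polynomial.monom (f j) j) i = (if i < t then f i else 0)"
  by (simp add: coeff_sum)

lemma coeffs_sum_monom:
  fixes f :: "nat \<Rightarrow> 'b::comm_ring_1"
  assumes "\<And>j. j < t \<Longrightarrow> f j \<noteq> 0"
  shows "coeffs (\<Sum>j<t. Polynomial.monom (f j) j) = map f [0..<t]"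
proof (cases t)
  case (Suc m)
  let ?p = "\<Sum>j<t. Polynomial.monom (f j) j"
  have deg: "degree ?p = m"
  proof (rule antisym)
    show "degree ?p \<le> m" by (rule degree_le) (auto simp: coeff_sum_monom Suc)
    show "m \<le> degree ?p" using assms[of m] by (intro le_degree) (simp add: coeff_sum_monom Suc)
  qed
  have "?p \<noteq> 0" using assms[of m] coeff_sum_monom[of f t m] Suc by (metis coeff_0 lessI)
  then show ?thesis
    unfolding coeffs_def deg by (auto simp: coeff_sum_monom Suc simp del: upt_Suc)
qed simp

lemma merit_factor_map:
  fixes f :: "int \<Rightarrow> int"
  shows "merit_factor (map (\<lambda>j. f (int j)) [0..<t]) =
    real t ^ 2 / (2 * (\<Sum>u\<in>{1..<int t}. (\<Sum>j\<in>{0..<int t-u}. real_of_int (f j) * real_of_int (f (j + u))) ^ 2))"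
proof -
  have ac: "real_of_int (autocorrelation (map (\<lambda>j. f (int j)) [0..<t]) u) =
      (\<Sum>j\<in>{0..<int t - int u}. real_of_int (f j) * real_of_int (f (j + int u)))" if "u < t" for u
  proof -
    have "real_of_int (autocorrelation (map (\<lambda>j. f (int j)) [0..<t]) u) =
       (\<Sum>j<t-u. real_of_int (f (int j)) * real_of_int (f (int j + int u)))"
      unfolding autocorrelation_def by simp
    also have "\<dots> = (\<Sum>j\<in>{0..<int t - int u}. real_of_int (f j) * real_of_int (f (j + int u)))"
      by (rule sum.reindex_bij_witness[of _ nat int]) (use that in auto)
    finally show ?thesis .
  qed
  have "(\<Sum>u\<in>{1..<t}. real_of_int (autocorrelation (map (\<lambda>j. f (int j)) [0..<t]) u) ^ 2) =
     (\<Sum>u\<in>{1..<t}. (\<Sum>j\<in>{0..<int t - int u}. real_of_int (f j) * real_of_int (f (j + int u))) ^ 2)"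
    by (intro sum.cong refl) (simp add: ac)
  also have "\<dots> = (\<Sum>u\<in>{1..<int t}. (\<Sum>j\<in>{0..<int t-u}. real_of_int (f j) * real_of_int (f (j + u))) ^ 2)"
    by (rule sum.reindex_bij_witness[of _ nat int]) auto
  finally show ?thesis by (simp add: merit_factor_def)
qed

lemma poly_merit_factor_shift:
  assumes nz: "\<And>j. periodic_coeff A j \<noteq> 0"
  shows "poly_merit_factor (shift_poly A r t) =
    real t ^ 2 / (2 * (\<Sum>u\<in>{1..<int t}. (\<Sum>j\<in>{0..<int t-u}.
      real_of_int (periodic_coeff A (j + r)) * real_of_int (periodic_coeff A (j + u + r))) ^ 2))"
  unfolding poly_merit_factor_def shift_poly_def
  using merit_factor_map[of "\<lambda>j. periodic_coeff A (j + r)" t] nz by (subst coeffs_sum_monom) auto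

lemma periodic_coeff_sum_monom:
  fixes f :: "nat \<Rightarrow> int"
  assumes nz: "\<And>j. j < m \<Longrightarrow> f j \<noteq> 0"
  shows "periodic_coeff (\<Sum>j<m. Polynomial.monom (f j) j) k = f (nat (k mod int m)) \<or> m = 0"
    "poly_length (\<Sum>j<m. Polynomial.monom (f j) j) = m"
proof -
  show len: "poly_length (\<Sum>j<m. Polynomial.monom (f j) j) = m"
    unfolding poly_length_def by (subst coeffs_sum_monom) (use nz in auto)
  have "nat (k mod int m) < m" if "m > 0" using that by (simp add: nat_less_iff)
  then show "periodic_coeff (\<Sum>j<m. Polynomial.monom (f j) j) k = f (nat (k mod int m)) \<or> m = 0"
    unfolding periodic_coeff_def len coeff_sum_monom by auto
qed

definition sign_N :: "int \<Rightarrow> int" where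
  "sign_N k = (if k mod 4 \<le> 1 then 1 else - 1)"

definition sign_P :: "int \<Rightarrow> int" where
  "sign_P k = (if k mod 4 = 2 then - 1 else 1)"

lemma nat_mod_4_cases:
  obtains m where "j = 4 * m" | m where "j = 4 * m + 1" | m where "j = 4 * m + 2" | m where "j = 4 * m + (3::nat)"
proof -
  have "j = 4 * (j div 4) + j mod 4" by simp
  moreover have "j mod 4 \<in> {0, 1, 2, 3}" by auto
  ultimately show ?thesis using that by (metis add_0_right insertE singletonD)
qed

lemma sign_N_power: "(- 1) ^ (j * (j - 1) div 2) = sign_N (int j)"
proof (cases j rule: nat_mod_4_cases)
  case (1 m)
  have "j * (j - 1) div 2 = 2 * (m * (j - 1))" using 1 by simp
  moreover have "int j mod 4 = 0" using 1 by simp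
  ultimately show ?thesis by (simp only: sign_N_def power_mult) simp
next
  case (2 m)
  have "j * (j - 1) div 2 = 2 * (j * m)" using 2 by simp
  moreover have "int j mod 4 = 1" using 2 by simp
  ultimately show ?thesis by (simp only: sign_N_def power_mult) simp
next
  case (3 m)
  have "j * (j - 1) = 2 * ((2 * m + 1) * (4 * m + 1))" using 3 by simp
  then have "j * (j - 1) div 2 = 2 * (4 * m * m + 3 * m) + 1" by (simp add: algebra_simps)
  moreover have "int j mod 4 = 2" using 3 by simp
  ultimately show ?thesis by (simp only: sign_N_def power_add power_mult) simp
next
  case (4 m)
  have "j * (j - 1) = 2 * ((4 * m + 3) * (2 * m + 1))" using 4 by simp
  then have "j * (j - 1) div 2 = 2 * (4 * m * m + 5 * m + 1) + 1" by (simp add: algebra_simps)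
  moreover have "int j mod 4 = 3" using 4 by simp
  ultimately show ?thesis by (simp only: sign_N_def power_add power_mult) simp
qed

lemma sign_P_power: "(- 1) ^ (j * (j - 1) ^ 2 div 2) = sign_P (int j)"
proof (cases j rule: nat_mod_4_cases)
  case (1 m)
  have "j * (j - 1) ^ 2 div 2 = 2 * (m * (j - 1) ^ 2)" using 1 by simp
  moreover have "int j mod 4 = 0" using 1 by simp
  ultimately show ?thesis by (simp only: sign_P_def power_mult) simp
next
  case (2 m)
  have "j * (j - 1) ^ 2 = 2 * (2 * (j * (4 * m * m)))" using 2 by (simp add: power2_eq_square)
  then have "j * (j - 1) ^ 2 div 2 = 2 * (j * (4 * m * m))"
    by (metis nonzero_mult_div_cancel_left zero_neq_numeral)
  moreover have "int j mod 4 = 1" using 2 by simp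
  ultimately show ?thesis by (simp only: sign_P_def power_mult) simp
next
  case (3 m)
  have "j * (j - 1) ^ 2 = 2 * (2 * (16 * m * m * m + 16 * m * m + 5 * m) + 1)"
    using 3 by (simp add: power2_eq_square algebra_simps)
  then have "j * (j - 1) ^ 2 div 2 = 2 * (16 * m * m * m + 16 * m * m + 5 * m) + 1"
    by (metis nonzero_mult_div_cancel_left zero_neq_numeral)
  moreover have "int j mod 4 = 2" using 3 by simp
  ultimately show ?thesis by (simp only: sign_P_def power_add power_mult) simp
next
  case (4 m)
  have "j * (j - 1) ^ 2 = 2 * (2 * (j * (2 * m + 1) ^ 2))"
    using 4 by (simp add: power2_eq_square algebra_simps)
  then have "j * (j - 1) ^ 2 div 2 = 2 * (j * (2 * m + 1) ^ 2)"
    by (metis nonzero_mult_div_cancel_left zero_neq_numeral)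
  moreover have "int j mod 4 = 3" using 4 by simp
  ultimately show ?thesis by (simp only: sign_P_def power_mult) simp
qed

lemma sign_N_constant: "2 dvd u \<Longrightarrow> sign_N j * sign_N (j + u) = sign_N k * sign_N (k + u)"
proof -
  have "sign_N j * sign_N (j + u) = (if u mod 4 = 0 then 1 else - 1)" if "2 dvd u" for j
    using that unfolding sign_N_def by (simp split: if_splits) presburger
  then show "2 dvd u \<Longrightarrow> sign_N j * sign_N (j + u) = sign_N k * sign_N (k + u)" by simp
qed

lemma sign_N_balanced: "\<not> 2 dvd u \<Longrightarrow> (\<Sum>k\<in>{0..<4}. sign_N k * sign_N (k + u)) = 0"
proof -
  assume "\<not> 2 dvd u"
  then have u: "u mod 4 = 1 \<or> u mod 4 = 3" by presburger
  define v where "v = u mod 4"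
  have shift: "sign_N (k + u) = sign_N (k + v)" for k
    by (simp add: sign_N_def v_def mod_add_right_eq)
  have "(\<Sum>k\<in>{0..<0+4}. sign_N k * sign_N (k + u)) = 0"
    unfolding sum_4 shift using u unfolding v_def[symmetric] by (auto simp: sign_N_def)
  then show ?thesis by simp
qed

lemma sign_P_balanced: "\<not> 4 dvd u \<Longrightarrow> (\<Sum>k\<in>{0..<4}. sign_P k * sign_P (k + u)) = 0"
proof -
  assume "\<not> 4 dvd u"
  then have u: "u mod 4 = 1 \<or> u mod 4 = 2 \<or> u mod 4 = 3" by presburger
  define v where "v = u mod 4"
  have shift: "sign_P (k + u) = sign_P (k + v)" for k
    by (simp add: sign_P_def v_def mod_add_right_eq)
  have "(\<Sum>k\<in>{0..<0+4}. sign_P k * sign_P (k + u)) = 0"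
    unfolding sum_4 shift using u unfolding v_def[symmetric] by (auto simp: sign_P_def)
  then show ?thesis by simp
qed

lemma sign_P_constant: "4 dvd u \<Longrightarrow> sign_P j * sign_P (j + u) = sign_P k * sign_P (k + u)"
proof -
  have "sign_P j * sign_P (j + u) = 1" if "4 dvd u" for j
    using that unfolding sign_P_def by (simp split: if_splits) presburger
  then show "4 dvd u \<Longrightarrow> sign_P j * sign_P (j + u) = sign_P k * sign_P (k + u)" by simp
qed

text \<open>
  The conditions on the signs in \<open>sign_pattern\<close>, before rotation by \<open>r\<close>.
\<close>
definition admissible_sign :: "int \<Rightarrow> (int \<Rightarrow> int) \<Rightarrow> bool" where
  "admissible_sign q \<epsilon> \<longleftrightarrow> q > 0 \<and> q dvd 4 \<and> (\<forall>k. \<epsilon> (k + 4) = \<epsilon> k) \<and> (\<forall>k. \<epsilon> k * \<epsilon> k = 1) \<and>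
     (\<forall>u j k. q dvd u \<longrightarrow> \<epsilon> j * \<epsilon> (j + u) = \<epsilon> k * \<epsilon> (k + u)) \<and>
     (\<forall>u. \<not> q dvd u \<longrightarrow> (\<Sum>k\<in>{0..<4}. \<epsilon> k * \<epsilon> (k + u)) = 0)"

lemma admissible_1: "admissible_sign 1 (\<lambda>_. 1)"
  by (simp add: admissible_sign_def)

lemma admissible_N: "admissible_sign 2 sign_N"
  using sign_N_constant sign_N_balanced unfolding admissible_sign_def by (auto simp: sign_N_def)

lemma admissible_P: "admissible_sign 4 sign_P"
  using sign_P_constant sign_P_balanced unfolding admissible_sign_def by (auto simp: sign_P_def)

context galois_field
begin

lemma galois_coeff:
  "periodic_coeff (galois_poly K d \<theta>) k = m_seq k" "poly_length (galois_poly K d \<theta>) = n"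
proof -
  have nz: "add_char K d y \<noteq> 0" for y by (simp add: add_char_def)
  show "poly_length (galois_poly K d \<theta>) = n"
    unfolding galois_poly_def n_def by (rule periodic_coeff_sum_monom) (rule nz)
  show "periodic_coeff (galois_poly K d \<theta>) k = m_seq k"
    using periodic_coeff_sum_monom(1)[of n "\<lambda>j. add_char K d (\<theta> [^] j)" k] nz n_pos
    unfolding galois_poly_def n_def[symmetric] m_seq_def power_at_def by auto
qed

lemma m_seq_mod: "m_seq (k mod (4 * int n)) = m_seq k"
  unfolding m_seq_def power_at_def by (simp add: mod_mod_cancel)

text \<open>
  The common form of \<open>N(A)\<close> and \<open>P(A)\<close>. The period \<open>4n\<close> is a multiple of the periods of both factors, so
  the periodic extension of the products is the product of the extensions.
\<close>
lemma twisted_coeff: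
  assumes w: "\<And>j. w j = \<epsilon> (int j)" and nz: "\<And>k. \<epsilon> k \<noteq> (0::int)" and per: "\<And>k. \<epsilon> (k + 4) = \<epsilon> k"
  shows "periodic_coeff (\<Sum>j<4 * poly_length (galois_poly K d \<theta>).
    Polynomial.monom (w j * periodic_coeff (galois_poly K d \<theta>) (int j)) j) k = \<epsilon> k * m_seq k"
proof -
  let ?f = "\<lambda>j. w j * m_seq (int j)"
  have mz: "m_seq i \<noteq> 0" for i using m_seq_square[of i] by auto
  have "\<epsilon> (k mod (4 * int n) mod 4) = \<epsilon> (k mod (4 * int n))" "\<epsilon> (k mod 4) = \<epsilon> k"
    by (rule periodic_mod[of \<epsilon> 4, OF per])+
  then have e: "\<epsilon> (k mod (4 * int n)) = \<epsilon> k" by (simp add: mod_mod_cancel)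
  have "periodic_coeff (\<Sum>j<4 * n. Polynomial.monom (?f j) j) k = ?f (nat (k mod int (4 * n)))"
    using periodic_coeff_sum_monom(1)[of "4 * n" ?f k] n_pos w nz mz by auto
  also have "\<dots> = \<epsilon> k * m_seq k"
    using n_pos by (simp add: w e m_seq_mod)
  finally show ?thesis by (simp add: galois_coeff)
qed

lemma N_coeff: "periodic_coeff (N_poly (galois_poly K d \<theta>)) k = sign_N k * m_seq k"
  unfolding N_poly_def by (rule twisted_coeff) (rule sign_N_power, auto simp: sign_N_def)

lemma P_coeff: "periodic_coeff (P_poly (galois_poly K d \<theta>)) k = sign_P k * m_seq k"
  unfolding P_poly_def by (rule twisted_coeff) (rule sign_P_power, auto simp: sign_P_def)

lemma sign_pattern_m_seq:
  assumes "d \<ge> 2" "t \<ge> 1" "admissible_sign q \<epsilon>"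
  shows "sign_pattern (int n) (\<lambda>k. real_of_int (m_seq (k + r))) zech (\<lambda>k. real_of_int (\<epsilon> (k + r))) q (int t)"
proof -
  interpret shift_and_add "int n" "\<lambda>k. real_of_int (m_seq (k + r))" zech
    by (rule shift_and_add_m_seq[OF assms(1)])
  have per: "\<epsilon> (k + 4) = \<epsilon> k" for k using assms(3) by (simp add: admissible_sign_def)
  show ?thesis
  proof
    show "q > 0" "q dvd 4" "int t \<ge> 1" using assms by (auto simp: admissible_sign_def)
    show "real_of_int (\<epsilon> (k + 4 + r)) = real_of_int (\<epsilon> (k + r))" for k
      using per[of "k + r"] by (simp add: ac_simps)
    show "real_of_int (\<epsilon> (k + r)) * real_of_int (\<epsilon> (k + r)) = 1" for k
      using assms(3) by (simp add: admissible_sign_def flip: of_int_mult)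
    show "real_of_int (\<epsilon> (j + r)) * real_of_int (\<epsilon> (j + u + r)) = real_of_int (\<epsilon> (k + r)) * real_of_int (\<epsilon> (k + u + r))"
      if "q dvd u" for u j k
    proof -
      have "\<epsilon> (j + r) * \<epsilon> (j + r + u) = \<epsilon> (k + r) * \<epsilon> (k + r + u)"
        using assms(3) that unfolding admissible_sign_def by blast
      then show ?thesis by (simp add: ac_simps flip: of_int_mult)
    qed
    show "(\<Sum>k\<in>{0..<4}. real_of_int (\<epsilon> (k + r)) * real_of_int (\<epsilon> (k + u + r))) = 0"
      if "\<not> q dvd u" for u
    proof -
      have per': "\<epsilon> (k + 4 + u) = \<epsilon> (k + u)" for k
        using per[of "k + u"] by (simp add: ac_simps)
      have "(\<Sum>k\<in>{0..<4}. \<epsilon> (k + r) * \<epsilon> (k + r + u)) = (\<Sum>k\<in>{0..<4}. \<epsilon> k * \<epsilon> (k + u))"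
        by (rule sum_periodic_shift[of 4 "\<lambda>k. \<epsilon> k * \<epsilon> (k + u)"]) (simp, simp only: per per')
      also have "\<dots> = 0" using assms(3) that by (simp add: admissible_sign_def)
      finally show ?thesis by (simp add: ac_simps flip: of_int_mult of_int_sum)
    qed
  qed
qed

end

text \<open>
  The three parts of the final theorem are the instances \<open>q = 1, 2, 4\<close>, with the sign patterns \<open>++++\<close>, \<open>++--\<close> and \<open>++-+\<close>.
\<close>
theorem galois_merit_factor_limit:
  fixes K :: "nat \<Rightarrow> ('a, 'b) ring_scheme" and A :: "nat \<Rightarrow> int poly"
  assumes field: "\<And>d. d \<ge> 1 \<Longrightarrow> galois_field (K d) d (\<theta> d)"
    and adm: "admissible_sign q \<epsilon>" and T: "T > 0"
    and coeff: "\<And>d k. d \<ge> 1 \<Longrightarrow> periodic_coeff (A d) k = \<epsilon> k * galois_field.m_seq (K d) d (\<theta> d) k"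
    and lim: "(\<lambda>d. real (t d) / (real_of_int q * real (2 ^ d - 1))) \<longlonglongrightarrow> T"
  shows "(\<lambda>d. poly_merit_factor (shift_poly (A d) (r d) (t d))) \<longlonglongrightarrow> h T"
proof -
  define x where "x = (\<lambda>d k. real_of_int (galois_field.m_seq (K d) d (\<theta> d) (k + r d)))"
  define \<eta> where "\<eta> = (\<lambda>d k. real_of_int (\<epsilon> (k + r d)))"
  have n_eq: "galois_field.n d = 2 ^ d - 1" if "d \<ge> 1" for d
    using galois_field.n_def[OF field[OF that]] .
  have tpos: "\<forall>\<^sub>F d in sequentially. t d \<ge> 1"
    using order_tendstoD(1)[OF lim T] by eventually_elim (auto intro: ccontr simp: not_le)
  have pat: "\<forall>\<^sub>F d in sequentially. sign_pattern (int (2 ^ d - 1)) (x d) (galois_field.zech (K d) d (\<theta> d)) (\<eta> d) q (int (t d))"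
    using tpos eventually_ge_at_top[of 2]
  proof eventually_elim
    case (elim d)
    then interpret galois_field "K d" d "\<theta> d" by (intro field) simp
    show ?case
      using sign_pattern_m_seq[OF elim(2,1) adm, of "r d"] by (simp add: x_def \<eta>_def n_def)
  qed
  have "(\<lambda>d. real_of_int (int (t d)) ^ 2 / (2 * (\<Sum>u\<in>{1..<int (t d)}. sign_pattern.corr (x d) (\<eta> d) (int (t d)) u ^ 2))) \<longlonglongrightarrow> h T"
  proof (rule merit_factor_limit[OF pat _ _ T])
    show "filterlim (\<lambda>d. real_of_int (int (2 ^ d - 1))) at_top sequentially"
    proof -
      have "filterlim (\<lambda>d. 2 ^ d - 1 :: real) at_top sequentially" by real_asymp
      then show ?thesis by (simp add: of_nat_diff)
    qed
    show "(\<lambda>d. real_of_int (int (t d)) / (real_of_int q * real_of_int (int (2 ^ d - 1)))) \<longlonglongrightarrow> T"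
      using lim by simp
  qed
  moreover have "\<forall>\<^sub>F d in sequentially.
    real_of_int (int (t d)) ^ 2 / (2 * (\<Sum>u\<in>{1..<int (t d)}. sign_pattern.corr (x d) (\<eta> d) (int (t d)) u ^ 2))
     = poly_merit_factor (shift_poly (A d) (r d) (t d))"
    using pat eventually_ge_at_top[of 1]
  proof eventually_elim
    case (elim d)
    interpret galois_field "K d" d "\<theta> d" by (intro field elim)
    have e: "\<epsilon> k \<noteq> 0" for k using adm unfolding admissible_sign_def by (metis mult_zero_left zero_neq_one)
    have m: "m_seq k \<noteq> 0" for k using m_seq_square[of k] by auto
    have nz: "periodic_coeff (A d) k \<noteq> 0" for k
      using e m coeff[OF elim(2)] by simp
    show ?case
      unfolding poly_merit_factor_shift[of "A d", OF nz] sign_pattern.corr_def[OF elim(1)]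
      by (simp add: coeff[OF elim(2)] x_def \<eta>_def mult_ac)
  qed
  ultimately show ?thesis by (rule Lim_transform_eventually)
qed

theorem theorem2p2:
  fixes K :: "nat \<Rightarrow> 'a ring"
    and \<theta> :: "nat \<Rightarrow> 'a"
    and r :: "nat \<Rightarrow> int"
    and t :: "nat \<Rightarrow> nat"
    and T :: real
  assumes field: "\<And>d. d \<ge> 1 \<Longrightarrow> field (K d)"
    and card: "\<And>d. d \<ge> 1 \<Longrightarrow> card (carrier (K d)) = 2 ^ d"
    and prim: "\<And>d. d \<ge> 1 \<Longrightarrow> primitive_element (K d) (\<theta> d)"
    and T: "T > 0"
  shows
    "((\<lambda>d. real (t d) / real (2 ^ d - 1)) \<longlonglongrightarrow> T \<longrightarrow>
        (\<lambda>d. poly_merit_factor (shift_poly (galois_poly (K d) d (\<theta> d)) (r d) (t d)))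
          \<longlonglongrightarrow> h T) \<and>
     ((\<lambda>d. real (t d) / (2 * real (2 ^ d - 1))) \<longlonglongrightarrow> T \<longrightarrow>
        (\<lambda>d. poly_merit_factor (shift_poly (N_poly (galois_poly (K d) d (\<theta> d))) (r d) (t d)))
          \<longlonglongrightarrow> h T) \<and>
     ((\<lambda>d. real (t d) / (4 * real (2 ^ d - 1))) \<longlonglongrightarrow> T \<longrightarrow>
        (\<lambda>d. poly_merit_factor (shift_poly (P_poly (galois_poly (K d) d (\<theta> d))) (r d) (t d)))
          \<longlonglongrightarrow> h T)"
proof -
  have gf: "galois_field (K d) d (\<theta> d)" if "d \<ge> 1" for d
    using that by (intro galois_field.intro galois_field_axioms.intro field card prim)
  note lim = galois_merit_factor_limit[where K = K and \<theta> = \<theta> and t = t and r = r, OF gf _ T]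
  show ?thesis
  proof (intro conjI impI)
    assume "(\<lambda>d. real (t d) / real (2 ^ d - 1)) \<longlonglongrightarrow> T"
    then show "(\<lambda>d. poly_merit_factor (shift_poly (galois_poly (K d) d (\<theta> d)) (r d) (t d))) \<longlonglongrightarrow> h T"
      by (intro lim[OF _ admissible_1]) (auto simp: galois_field.galois_coeff[OF gf])
  next
    assume "(\<lambda>d. real (t d) / (2 * real (2 ^ d - 1))) \<longlonglongrightarrow> T"
    then show "(\<lambda>d. poly_merit_factor (shift_poly (N_poly (galois_poly (K d) d (\<theta> d))) (r d) (t d))) \<longlonglongrightarrow> h T"
      by (intro lim[OF _ admissible_N]) (auto simp: galois_field.N_coeff[OF gf])
  next
    assume "(\<lambda>d. real (t d) / (4 * real (2 ^ d - 1))) \<longlonglongrightarrow> T"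
    then show "(\<lambda>d. poly_merit_factor (shift_poly (P_poly (galois_poly (K d) d (\<theta> d))) (r d) (t d))) \<longlonglongrightarrow> h T"
      by (intro lim[OF _ admissible_P]) (auto simp: galois_field.P_coeff[OF gf])
  qed
qed

end
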